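(* Let $n\ge1$, $-\frac1n<\alpha<0$, $\kappa=\frac{\alpha}{1+n\alpha}$, and $f\in C_\alpha(\mathbb{R}^n)$. Then $$w_\alpha(f)\ge\int G_\alpha\cdot\Big[\frac n2+\frac1\kappa\Big(\frac{\int f}{\int G_\alpha}\Big)^{\kappa}-\frac1\kappa\Big].$$
   Context: For $-\infty<\alpha<0$, a function $f:\mathbb{R}^n\to[0,\infty)$ is $\alpha$-concave if it is supported on a convex set $\Omega$ and $f(\lambda x+(1-\lambda)y)\ge[\lambda f(x)^\alpha+(1-\lambda)f(y)^\alpha]^{1/\alpha}$ for all $x,y\in\Omega$, $\lambda\in[0,1]$. $C_\alpha(\mathbb{R}^n)$ is the set of upper semicontinuous $\alpha$-concave $f\not\equiv0$. With $\beta=-1/\alpha$, $\mathrm{base}_\alpha(f)=\frac{1-f^\alpha}{\alpha}$ (with $0^\alpha=+\infty$); equivalently $f=(1+\mathrm{base}_\alpha f/\beta)^{-\beta}$. The $\alpha$-sum is defined by $\mathrm{base}_\alpha(f\star_\alpha g)=(\mathrm{base}_\alpha f)\square(\mathrm{base}_\alpha g)$ with $(\phi\square\psi)(x)=\inf_{y+z=x}[\phi(y)+\psi(z)]$, and $\mathrm{base}_\alpha(\lambda\cdot_\alpha f)(x)=\lambda(\mathrm{base}_\alpha f)(x/\lambda)$ for $\lambda>0$. $G_\alpha(x)=(1+\frac{|x|^2}{2\beta})^{-\beta}$, and $w_\alpha(f)=\lim_{\epsilon\to0^+}\frac{\int G_\alpha\star_\alpha[\epsilon\cdot_\alpha f]-\int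 G_\alpha}{\epsilon}$. If $\int f=+\infty$, $(\int f/\int G_\alpha)^\kappa$ is interpreted as $0$. *)

theory Defs
  imports "HOL-Analysis.Analysis"
begin

definition usc :: "('a::topological_space \<Rightarrow> real) \<Rightarrow> bool" where
  "usc f \<longleftrightarrow> (\<forall>x t. f x < t \<longrightarrow> (\<forall>\<^sub>F y in at x. f y < t))"

text \<open>The weighted alpha-mean \<open>[\<lambda> a^\<alpha> + (1-\<lambda>) b^\<alpha>]^(1/\<alpha>)\<close> for \<open>\<alpha> < 0\<close>, \<open>a, b \<ge> 0\<close>,
  with the conventions \<open>0^\<alpha> = +\<infinity>\<close>, \<open>0 \<cdot> \<infinity> = 0\<close>, \<open>(+\<infinity>)^(1/\<alpha>) = 0\<close>.\<close>
definition amean :: "real \<Rightarrow> real \<Rightarrow> real \<Rightarrow> real \<Rightarrow> real" where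
  "amean \<alpha> l a b =
     (if (a = 0 \<and> l > 0) \<or> (b = 0 \<and> l < 1) then 0
      else (l * (if l = 0 then 0 else a powr \<alpha>) + (1 - l) * (if l = 1 then 0 else b powr \<alpha>))
             powr (1 / \<alpha>))"

definition alpha_concave :: "real \<Rightarrow> ('a::euclidean_space \<Rightarrow> real) \<Rightarrow> bool" where
  "alpha_concave \<alpha> f \<longleftrightarrow> (\<forall>x. f x \<ge> 0) \<and>
     (\<exists>\<Omega>. convex \<Omega> \<and> (\<forall>x. x \<notin> \<Omega> \<longrightarrow> f x = 0) \<and>
        (\<forall>x\<in>\<Omega>. \<forall>y\<in>\<Omega>. \<forall>l\<in>{0..1}. f (l *\<^sub>R x + (1 - l) *\<^sub>R y) \<ge> amean \<alpha> l (f x) (f y)))"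

definition C_alpha :: "real \<Rightarrow> ('a::euclidean_space \<Rightarrow> real) set" where
  "C_alpha \<alpha> = {f. usc f \<and> alpha_concave \<alpha> f \<and> (\<exists>x. f x \<noteq> 0)}"

text \<open>\<open>base_\<alpha>(f) = (1 - f^\<alpha>)/\<alpha>\<close> with \<open>0^\<alpha> = +\<infinity>\<close> (so base is \<open>+\<infinity>\<close> where \<open>f = 0\<close>).\<close>
definition base :: "real \<Rightarrow> ('a \<Rightarrow> real) \<Rightarrow> 'a \<Rightarrow> ereal" where
  "base \<alpha> f x = (if f x = 0 then \<infinity> else ereal ((1 - f x powr \<alpha>) / \<alpha>))"

text \<open>Inverse of base: \<open>f = (1 + b/\<beta>)^(-\<beta>)\<close>, \<open>\<beta> = -1/\<alpha>\<close>; \<open>b = +\<infinity>\<close> gives \<open>0\<close>.\<close>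
definition unbase :: "real \<Rightarrow> ereal \<Rightarrow> real" where
  "unbase \<alpha> b = (case b of ereal r \<Rightarrow> (1 + r / (-1/\<alpha>)) powr (-(-1/\<alpha>)) | _ \<Rightarrow> 0)"

definition infconv :: "('a::ab_group_add \<Rightarrow> ereal) \<Rightarrow> ('a \<Rightarrow> ereal) \<Rightarrow> 'a \<Rightarrow> ereal" where
  "infconv \<phi> \<psi> x = (INF y. \<phi> y + \<psi> (x - y))"

definition alpha_sum :: "real \<Rightarrow> ('a::euclidean_space \<Rightarrow> real) \<Rightarrow> ('a \<Rightarrow> real) \<Rightarrow> 'a \<Rightarrow> real" where
  "alpha_sum \<alpha> f g x = unbase \<alpha> (infconv (base \<alpha> f) (base \<alpha> g) x)"

definition alpha_scale :: "real \<Rightarrow> real \<Rightarrow> ('a::euclidean_space \<Rightarrow> real) \<Rightarrow> 'a \<Rightarrow> real" where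
  "alpha_scale \<alpha> l f x = unbase \<alpha> (ereal l * base \<alpha> f ((1 / l) *\<^sub>R x))"

definition G_alpha :: "real \<Rightarrow> 'a::euclidean_space \<Rightarrow> real" where
  "G_alpha \<alpha> x = (1 + norm x ^ 2 / (2 * (-1/\<alpha>))) powr (-(-1/\<alpha>))"

definition integ :: "('a::euclidean_space \<Rightarrow> real) \<Rightarrow> ereal" where
  "integ f = enn2ereal (\<integral>\<^sup>+ x. ennreal (f x) \<partial>lborel)"

definition w_alpha :: "real \<Rightarrow> ('a::euclidean_space \<Rightarrow> real) \<Rightarrow> ereal" where
  "w_alpha \<alpha> f = Lim (at_right 0)
     (\<lambda>\<epsilon>. (integ (alpha_sum \<alpha> (G_alpha \<alpha>) (alpha_scale \<alpha> \<epsilon> f)) - integ (G_alpha \<alpha> :: 'a \<Rightarrow> real)) * ereal (1 / \<epsilon>))"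

text \<open>\<open>(\<integral>f / \<integral>G)^\<kappa>\<close> for \<open>\<kappa> < 0\<close>: \<open>0\<close> if \<open>\<integral>f = \<infinity>\<close>, \<open>+\<infinity>\<close> if \<open>\<integral>f = 0\<close>.\<close>
definition ratio_pow :: "ereal \<Rightarrow> real \<Rightarrow> real \<Rightarrow> ereal" where
  "ratio_pow I IG \<kappa> = (if I = \<infinity> then 0 else if I = 0 then \<infinity> else ereal ((real_of_ereal I / IG) powr \<kappa>))"

end

theory Submission
  imports Defs "HOL-Probability.Sinc_Integral"
begin

text \<open>
  Write \<open>b = -1/\<alpha>\<close> and \<open>F t = \<integral> G \<star> (t \<cdot> f)\<close>. The Borell--Brascamp--Lieb inequality with
  exponent \<open>\<alpha>\<close> makes \<open>F^\<kappa>\<close> satisfy the chord inequality at \<open>0\<close>: the quotients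
  \<open>(F(t)^\<kappa> - F(0)^\<kappa>) / t\<close> increase with \<open>t\<close>, hence converge (possibly to \<open>-\<infinity>\<close>) as \<open>t \<rightarrow> 0\<close>, and
  therefore the limit \<open>w\<close> exists. For the bound, \<open>1 + base(G \<star> (t \<cdot> f)) / b\<close> is the infimal convolution of
  \<open>1 - t + |x|^2 / (2b)\<close> and \<open>t f(x/t)^\<alpha>\<close>. The \<open>(-b)\<close>-th powers of these two have integrals
  \<open>(1-t)^(n/2 - b) \<integral>G\<close> and \<open>t^(n-b) \<integral>f\<close>, so that, since \<open>\<kappa> (n - b) = 1\<close>,
  \<open>F(t)^\<kappa> \<le> (1-t)^(\<kappa>(n/2-b)) (\<integral>G)^\<kappa> + t (\<integral>f)^\<kappa>\<close>; differentiating at \<open>t = 0\<close> gives the claim.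

  The one-dimensional Borell--Brascamp--Lieb inequality follows from \<open>|A + B| \<ge> |A| + |B|\<close> applied
  to superlevel sets at heights proportional to the two suprema; induction on the dimension and
  Fubini give the general case.
\<close>

section \<open>The Borell--Brascamp--Lieb inequality\<close>

lemma powr_Bernoulli:
  fixes t e :: real
  assumes "t \<ge> 0" "e \<ge> 1"
  shows "1 + e * (t - 1) \<le> t powr e"
proof (cases "t = 0")
  case True
  then show ?thesis using assms by simp
next
  case False
  have "((\<lambda>x. x powr e) has_real_derivative e) (at 1 within {0<..})"
    by (rule has_field_derivative_at_within) (auto intro!: derivative_eq_intros)
  then have "t powr e - 1 powr e \<ge> e * (t - 1)"
    using False assms by (intro convex_on_imp_above_tangent[OF powr_convex]) (auto simp: interior_open)
  then show ?thesis by simp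
qed

text \<open>The minimum over \<open>t\<close> of \<open>t^e a + (1 - t)^e b\<close> is attained at \<open>t = p / (p + q)\<close>, where the
  two terms \<open>t^(e-1) a\<close> and \<open>(1 - t)^(e-1) b\<close> agree.\<close>
lemma weighted_powr_min:
  fixes a b e :: real
  assumes "a > 0" "b > 0" "e > 1"
  defines "p \<equiv> a powr (- 1 / (e - 1))" and "q \<equiv> b powr (- 1 / (e - 1))"
  shows "(p / (p + q)) powr (e - 1) * a = (p + q) powr (1 - e)"
    and "(q / (p + q)) powr (e - 1) * b = (p + q) powr (1 - e)"
    and "0 \<le> t \<Longrightarrow> t \<le> 1 \<Longrightarrow> (p + q) powr (1 - e) \<le> t powr e * a + (1 - t) powr e * b"
proof -
  have pq: "p > 0" "q > 0" using assms by auto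
  have pe: "p powr (e - 1) = 1 / a" and qe: "q powr (e - 1) = 1 / b"
    using assms powr_powr[of a "- 1 / (e - 1)" "e - 1"] powr_powr[of b "- 1 / (e - 1)" "e - 1"]
    by (simp_all add: powr_minus_divide del: powr_powr)
  have *: "(x / (p + q)) powr (e - 1) = x powr (e - 1) * (p + q) powr (1 - e)" if "x > 0" for x
    using that pq by (simp add: powr_divide powr_diff field_simps)
  show 1: "(p / (p + q)) powr (e - 1) * a = (p + q) powr (1 - e)"
    and 2: "(q / (p + q)) powr (e - 1) * b = (p + q) powr (1 - e)"
    using *[OF pq(1)] *[OF pq(2)] pe qe assms by auto
  show "(p + q) powr (1 - e) \<le> t powr e * a + (1 - t) powr e * b" if t: "0 \<le> t" "t \<le> 1"
  proof -
    define l where "l = p / (p + q)"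
    define m where "m = (p + q) powr (1 - e)"
    have l: "0 < l" "l < 1" "1 - l = q / (p + q)" using pq by (auto simp: l_def field_simps)
    have la: "l powr (e - 1) * a = m" and lb: "(1 - l) powr (e - 1) * b = m"
      using 1 2 l(3) by (auto simp: l_def m_def)
    have m: "m > 0" using pq by (simp add: m_def)
    \<comment> \<open>The left side is the tangent at \<open>c\<close> of the convex function
      \<open>s powr e * x\<close>, obtained from Bernoulli at \<open>s / c\<close> after multiplying
      by \<open>c * m\<close>. In the sum of the tangents for \<open>t\<close> and
      \<open>1 - t\<close> the linear terms cancel and \<open>m\<close> remains.\<close>
    have *: "m * (c + e * (s - c)) \<le> s powr e * x"
      if c: "0 < c" and s: "0 \<le> s" and x: "c powr (e - 1) * x = m" for c s x
    proof -
      have "1 + e * (s / c - 1) \<le> (s / c) powr e"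
        using c s assms by (intro powr_Bernoulli) auto
      then have "c * m * (1 + e * (s / c - 1)) \<le> c * m * (s / c) powr e"
        using c m by (intro mult_left_mono) auto
      moreover have "c * m * (s / c) powr e = s powr e * x"
        using c s x[symmetric] by (simp add: powr_divide powr_diff field_simps)
      moreover have "c * m * (1 + e * (s / c - 1)) = m * (c + e * (s - c))"
        using c by (simp add: field_simps)
      ultimately show ?thesis by simp
    qed
    have "m = m * (l + e * (t - l)) + m * ((1 - l) + e * ((1 - t) - (1 - l)))"
      by (simp add: algebra_simps)
    also have "\<dots> \<le> t powr e * a + (1 - t) powr e * b"
      using *[OF l(1) t(1) la] *[OF _ _ lb, of "1 - t"] t l by auto
    finally show ?thesis by (simp add: m_def)
  qed
qed

section \<open>Brunn-Minkowski on the real line\<close>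

lemma emeasure_lborel_translate:
  fixes A :: "'a::euclidean_space set"
  assumes "A \<in> sets borel"
  shows "emeasure lborel ((\<lambda>x. x + c) ` A) = emeasure lborel A"
proof -
  have eq: "(\<lambda>x. x + c) ` A = (\<lambda>x. - c + x) -` A"
    by (auto simp: image_iff algebra_simps) (metis add.commute diff_add_cancel)
  have "emeasure lborel A = emeasure (distr lborel borel ((+) (- c))) A"
    by (simp add: lborel_distr_plus)
  also have "\<dots> = emeasure lborel ((\<lambda>x. - c + x) -` A)"
    using assms by (subst emeasure_distr) auto
  finally show ?thesis using eq by simp
qed

text \<open>\<open>C\<close> contains the translate of \<open>A\<close> by a point \<open>b\<close>
  near the left end of \<open>B\<close> and the translate of \<open>B\<close> by a point
  \<open>a\<close> near the right end of \<open>A\<close>. These translates overlap only inside an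
  interval of length below \<open>d\<close>, so their measures add up to within
  \<open>d\<close>.\<close>

lemma brunn_minkowski_real_bounded:
  fixes A B C :: "real set"
  assumes [measurable]: "A \<in> sets borel" "B \<in> sets borel" "C \<in> sets borel"
    and ne: "A \<noteq> {}" "B \<noteq> {}" and bd: "bdd_above A" "bdd_below B"
    and sub: "\<And>x y. x \<in> A \<Longrightarrow> y \<in> B \<Longrightarrow> x + y \<in> C"
  shows "emeasure lborel A + emeasure lborel B \<le> emeasure lborel C"
proof (rule ennreal_le_epsilon)
  fix d :: real assume d: "0 < d"
  obtain a where a: "a \<in> A" "Sup A - d / 2 < a"
    using less_cSupD[OF ne(1), of "Sup A - d / 2"] d by auto
  obtain b where b: "b \<in> B" "b < Inf B + d / 2"
    using cInf_lessD[OF ne(2), of "Inf B + d / 2"] d by auto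
  let ?A = "(\<lambda>x. x + b) ` A" and ?B = "(\<lambda>x. x + a) ` B"
  have tm: "(\<lambda>x. x + c) ` S \<in> sets borel" if "S \<in> sets borel" for S :: "real set" and c
  proof -
    have "(\<lambda>x. x + c) ` S = (\<lambda>x. x - c) -` S"
      by (auto simp: image_iff algebra_simps) (metis diff_add_cancel)
    moreover have "(\<lambda>x. x - c) -` S \<inter> space borel \<in> sets borel"
      using that by (intro measurable_sets[of _ borel borel]) auto
    ultimately show ?thesis by simp
  qed
  note tm[measurable]
  have sets: "?A \<in> sets lborel" "?B \<in> sets lborel" by auto
  have over: "?A \<inter> ?B \<subseteq> {Inf B + a .. Sup A + b}"
  proof
    fix z assume "z \<in> ?A \<inter> ?B"
    then obtain x y where "x \<in> A" "y \<in> B" "z = x + b" "z = y + a" by auto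
    then show "z \<in> {Inf B + a .. Sup A + b}"
      using cSup_upper[of x A] cInf_lower[of y B] bd by auto
  qed
  have le: "Inf B + a \<le> Sup A + b"
    using cSup_upper[of a A] cInf_lower[of b B] a b bd by auto
  have "emeasure lborel (?A \<inter> ?B) \<le> emeasure lborel {Inf B + a .. Sup A + b}"
    by (intro emeasure_mono over) auto
  also have "\<dots> \<le> ennreal d"
    using le a b by (simp add: ennreal_leI)
  finally have ov: "emeasure lborel (?A \<inter> ?B) \<le> ennreal d" .
  have "emeasure lborel A + emeasure lborel B = emeasure lborel ?A + emeasure lborel ?B"
    by (simp add: emeasure_lborel_translate)
  also have "\<dots> = emeasure lborel (?A \<union> ?B) + emeasure lborel (?A \<inter> ?B)"
    using sets by (rule emeasure_Un_Int)
  also have "\<dots> \<le> emeasure lborel C + ennreal d"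
    using a b sub[OF a(1)] sub[OF _ b(1)]
    by (intro add_mono ov emeasure_mono) (auto simp: add.commute)
  finally show "emeasure lborel A + emeasure lborel B \<le> emeasure lborel C + ennreal d" .
qed

text \<open>Exhaustion by truncated sets reduces this to the bounded case. The cuts are placed
  relative to \<open>a\<close> and \<open>b\<close>, so that every truncation contains one of these
  points and is nonempty.\<close>

lemma brunn_minkowski_real:
  fixes A B C :: "real set"
  assumes [measurable]: "A \<in> sets borel" "B \<in> sets borel" "C \<in> sets borel"
    and ne: "A \<noteq> {}" "B \<noteq> {}"
    and sub: "\<And>x y. x \<in> A \<Longrightarrow> y \<in> B \<Longrightarrow> x + y \<in> C"
  shows "emeasure lborel A + emeasure lborel B \<le> emeasure lborel C"
proof -
  obtain a b where ab: "a \<in> A" "b \<in> B" using ne by auto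
  let ?A = "\<lambda>k::nat. A \<inter> {.. a + k}" and ?B = "\<lambda>k::nat. B \<inter> {b - k ..}"
  have UA: "(\<Union>k. ?A k) = A"
  proof -
    have "\<exists>k::nat. x \<le> a + k" for x
      using real_arch_simple[of "x - a"] by (auto simp: algebra_simps)
    then show ?thesis by auto
  qed
  have UB: "(\<Union>k. ?B k) = B"
  proof -
    have "\<exists>k::nat. b - k \<le> x" for x
      using real_arch_simple[of "b - x"] by (auto simp: algebra_simps)
    then show ?thesis by auto
  qed
  have "(\<lambda>k. emeasure lborel (?A k)) \<longlonglongrightarrow> emeasure lborel (\<Union>k. ?A k)"
    by (rule Lim_emeasure_incseq) (auto simp: incseq_def)
  moreover have "(\<lambda>k. emeasure lborel (?B k)) \<longlonglongrightarrow> emeasure lborel (\<Union>k. ?B k)"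
    by (rule Lim_emeasure_incseq) (auto simp: incseq_def)
  ultimately have "(\<lambda>k. emeasure lborel (?A k) + emeasure lborel (?B k)) \<longlonglongrightarrow>
      emeasure lborel A + emeasure lborel B"
    unfolding UA UB by (intro tendsto_add) auto
  then show ?thesis
  proof (rule LIMSEQ_le_const2, intro exI allI impI)
    fix k :: nat
    show "emeasure lborel (?A k) + emeasure lborel (?B k) \<le> emeasure lborel C"
      using ab sub by (intro brunn_minkowski_real_bounded) auto
  qed
qed

section \<open>Layer cake formula and the one-dimensional inequality\<close>

lemma nn_integral_min_layer_cake:
  fixes g :: "'a \<Rightarrow> ennreal"
  assumes "sigma_finite_measure M" and [measurable]: "g \<in> borel_measurable M" and c: "0 < c"
  shows "(\<integral>\<^sup>+x. min (g x) (ennreal c) \<partial>M) =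
    ennreal c * (\<integral>\<^sup>+s\<in>{0<..<1}. emeasure M {x\<in>space M. ennreal (c * s) \<le> g x} \<partial>lborel)"
proof -
  interpret sigma_finite_measure M by fact
  interpret pair_sigma_finite lborel M ..
  \<comment> \<open>The \<open>s\<close> in (0,1) with \<open>c * s\<close> at most \<open>r\<close>
    form a set of length min(r/c, 1). Normalising heights to (0,1) allows functions with different
    suprema to be compared at the same \<open>s\<close>.\<close>
  have *: "min r (ennreal c) = ennreal c * (\<integral>\<^sup>+s. indicator {s\<in>{0<..<1}. ennreal (c * s) \<le> r} s \<partial>lborel)"
    for r
  proof (cases "r \<ge> ennreal c")
    case True
    have "{s\<in>{0<..<1}. ennreal (c * s) \<le> r} = {0<..<1}"
      using True c by (auto intro!: order_trans[OF ennreal_leI True])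
    then show ?thesis using True by (simp add: min_def)
  next
    case False
    then obtain t where t: "r = ennreal t" "0 \<le> t" "t < c"
      by (cases r) (auto simp: ennreal_le_iff2 not_le ennreal_less_iff)
    have "{s\<in>{0<..<1}. ennreal (c * s) \<le> r} = {0<..t / c}"
    proof (intro set_eqI iffI)
      fix s assume "s \<in> {s\<in>{0<..<1}. ennreal (c * s) \<le> r}"
      then show "s \<in> {0<..t / c}"
        using t c by (auto simp: ennreal_le_iff field_simps)
    next
      fix s assume s: "s \<in> {0<..t / c}"
      then have "s \<le> t / c" "t / c < 1" using t c by auto
      then have "s < 1" by linarith
      then show "s \<in> {s\<in>{0<..<1}. ennreal (c * s) \<le> r}"
        using s t c by (auto simp: ennreal_le_iff field_simps)
    qed
    then have "(\<integral>\<^sup>+s. indicator {s\<in>{0<..<1}. ennreal (c * s) \<le> r} s \<partial>lborel) = ennreal (t / c)"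
      using t c by simp
    then show ?thesis using t c False by (simp add: min_def ennreal_mult[symmetric])
  qed
  have "(\<integral>\<^sup>+x. min (g x) (ennreal c) \<partial>M) =
     (\<integral>\<^sup>+x. ennreal c * (\<integral>\<^sup>+s. indicator {s\<in>{0<..<1}. ennreal (c * s) \<le> g x} s \<partial>lborel) \<partial>M)"
    using * by simp
  also have "\<dots> = ennreal c * (\<integral>\<^sup>+x. (\<integral>\<^sup>+s. indicator {s\<in>{0<..<1}. ennreal (c * s) \<le> g x} s \<partial>lborel) \<partial>M)"
    by (rule nn_integral_cmult) measurable
  also have "(\<integral>\<^sup>+x. (\<integral>\<^sup>+s. indicator {s\<in>{0<..<1}. ennreal (c * s) \<le> g x} s \<partial>lborel) \<partial>M) =
    (\<integral>\<^sup>+s. (\<integral>\<^sup>+x. indicator {s\<in>{0<..<1}. ennreal (c * s) \<le> g x} s \<partial>M) \<partial>lborel)"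
    by (rule Fubini') measurable
  also have "\<dots> = (\<integral>\<^sup>+s\<in>{0<..<1}. emeasure M {x\<in>space M. ennreal (c * s) \<le> g x} \<partial>lborel)"
  proof (rule nn_integral_cong)
    fix s :: real
    have "(\<integral>\<^sup>+x. indicator {s\<in>{0<..<1}. ennreal (c * s) \<le> g x} s \<partial>M)
       = (\<integral>\<^sup>+x. indicator {x\<in>space M. ennreal (c * s) \<le> g x} x * indicator {0<..<1} s \<partial>M)"
      by (rule nn_integral_cong) (auto simp: indicator_def)
    also have "\<dots> = emeasure M {x\<in>space M. ennreal (c * s) \<le> g x} * indicator {0<..<1} s"
      by (subst nn_integral_multc) auto
    finally show "(\<integral>\<^sup>+x. indicator {s\<in>{0<..<1}. ennreal (c * s) \<le> g x} s \<partial>M) = \<dots>" .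
  qed
  finally show ?thesis .
qed

text \<open>Covers the degenerate mean: with a negative exponent, the mean of two numbers tends to
  the second when the first tends to infinity. One point \<open>x\<close> with \<open>u x\<close>
  huge therefore makes \<open>w (x + y)\<close> nearly as large as \<open>v y\<close> for all
  \<open>y\<close> at once, up to truncation.\<close>

lemma nn_integral_le_of_unbounded_summand:
  fixes u v w :: "real \<Rightarrow> ennreal" and e :: real
  assumes [measurable]: "v \<in> borel_measurable borel" "w \<in> borel_measurable borel"
    and e: "e > 0" and unbdd: "(SUP x. u x) = \<infinity>"
    and H: "\<And>x y. \<exists>l\<in>{0..1}. ennreal (l powr e) * u x + ennreal ((1 - l) powr e) * v y \<le> w (x + y)"
  shows "(\<integral>\<^sup>+x. v x \<partial>lborel) \<le> (\<integral>\<^sup>+x. w x \<partial>lborel)"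
proof -
  let ?W = "\<integral>\<^sup>+x. w x \<partial>lborel" and ?V = "\<integral>\<^sup>+x. v x \<partial>lborel"
  have *: "ennreal r * ?V \<le> ?W" if r: "0 < r" "r < 1" for r :: real
  proof -
    \<comment> \<open>Chosen so that \<open>(1 - l0) powr e = r\<close>. For weights
      \<open>l\<close> up to \<open>l0\<close> the \<open>v\<close> term alone is at least
      \<open>r * v y\<close>; for larger \<open>l\<close> the \<open>u\<close> term alone exceeds
      the truncation level \<open>k\<close>, by the choice of \<open>x\<close>.\<close>
    define l0 where "l0 = 1 - r powr (1 / e)"
    have "r powr (1 / e) < 1 powr (1 / e)" using r e by (intro powr_less_mono2) auto
    then have l0: "l0 > 0" by (simp add: l0_def)
    have r_eq: "(1 - l0) powr e = r" using r e by (simp add: l0_def powr_powr)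
    have l01: "1 - l0 \<ge> 0" by (simp add: l0_def)
    have trunc: "(\<integral>\<^sup>+y. min (ennreal r * v y) (of_nat k) \<partial>lborel) \<le> ?W" for k :: nat
    proof -
      have "\<exists>x. ennreal (k / l0 powr e) < u x"
        using unbdd less_SUP_iff[of "ennreal (k / l0 powr e)" u UNIV] by auto
      then obtain x where x: "ennreal (k / l0 powr e) < u x" by auto
      have "min (ennreal r * v y) (of_nat k) \<le> w (x + y)" for y
      proof -
        obtain l where l: "0 \<le> l" "l \<le> 1"
          and w: "ennreal (l powr e) * u x + ennreal ((1 - l) powr e) * v y \<le> w (x + y)"
          using H[of x y] by auto
        show ?thesis
        proof (cases "l \<le> l0")
          case True
          then have "r \<le> (1 - l) powr e"
            using l01 l e unfolding r_eq[symmetric] by (intro powr_mono2) auto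
          then have "ennreal r * v y \<le> ennreal ((1 - l) powr e) * v y"
            by (intro mult_right_mono ennreal_leI) auto
          also have "\<dots> \<le> w (x + y)" using w by (metis add_increasing zero_le order_trans order_refl)
          finally show ?thesis by (simp add: min.coboundedI1)
        next
          case False
          have "of_nat k = ennreal (l0 powr e) * ennreal (k / l0 powr e)"
            using l0 by (simp add: ennreal_mult[symmetric] ennreal_of_nat_eq_real_of_nat)
          also have "\<dots> \<le> ennreal (l powr e) * u x"
            using False x l0 e by (intro mult_mono ennreal_leI powr_mono2) auto
          also have "\<dots> \<le> w (x + y)" using w by (metis add_increasing2 zero_le order_trans order_refl)
          finally show ?thesis by (simp add: min.coboundedI2)
        qed
      qed
      then have "(\<integral>\<^sup>+y. min (ennreal r * v y) (of_nat k) \<partial>lborel) \<le> (\<integral>\<^sup>+y. w (x + y) \<partial>lborel)"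
        by (intro nn_integral_mono) auto
      also have "\<dots> = ?W"
        using nn_integral_real_affine[of w 1 x] by simp
      finally show ?thesis .
    qed
    have "ennreal r * ?V = (\<integral>\<^sup>+y. ennreal r * v y \<partial>lborel)"
      by (simp add: nn_integral_cmult)
    also have "\<dots> = (\<integral>\<^sup>+y. (SUP k::nat. min (ennreal r * v y) (of_nat k)) \<partial>lborel)"
    proof (rule nn_integral_cong)
      fix y :: real
      have "(SUP k::nat. min (ennreal r * v y) (of_nat k)) = min (ennreal r * v y) (SUP k::nat. of_nat k)"
        using inf_SUP[of "ennreal r * v y" of_nat "UNIV :: nat set"] by (simp add: inf_min)
      then show "ennreal r * v y = (SUP k::nat. min (ennreal r * v y) (of_nat k))"
        by (simp add: ennreal_SUP_of_nat_eq_top)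
    qed
    also have "\<dots> = (SUP k::nat. \<integral>\<^sup>+y. min (ennreal r * v y) (of_nat k) \<partial>lborel)"
      by (rule nn_integral_monotone_convergence_SUP)
         (auto simp: incseq_def le_fun_def intro!: min.coboundedI2 of_nat_mono)
    also have "\<dots> \<le> ?W" using trunc by (intro SUP_least)
    finally show ?thesis .
  qed
  show ?thesis
  proof (cases ?V)
    \<comment> \<open>For a finite integral, let \<open>r\<close> tend to 1 from the left; for an
      infinite one, a single \<open>r\<close> is enough.\<close>
    case (real c)
    have "((\<lambda>r. ennreal (r * c)) \<longlongrightarrow> ennreal (1 * c)) (at_left 1)"
      by (intro tendsto_ennrealI tendsto_mult tendsto_const tendsto_ident_at)
    moreover have "\<forall>\<^sub>F r in at_left (1::real). ennreal (r * c) \<le> ?W"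
      using eventually_at_left_real[OF zero_less_one]
    proof eventually_elim
      case (elim r)
      with *[of r] real show ?case by (simp add: ennreal_mult)
    qed
    ultimately have "ennreal (1 * c) \<le> ?W"
      by (rule tendsto_upperbound) auto
    then show ?thesis using real by simp
  next
    case top
    then show ?thesis using *[of "1 / 2"] by (simp add: ennreal_mult_top top_unique)
  qed
qed

text \<open>The minimum of \<open>l^e a + (1 - l)^e b\<close> over \<open>l\<close> is the mean
  \<open>(a^p + b^p)^(1/p)\<close> with \<open>p = -1/(e-1)\<close>, so quantifying existentially over \<open>l\<close> expresses a lower
  bound by this mean, and with the usual conventions when \<open>a\<close> or \<open>b\<close> is \<open>0\<close> or \<open>\<infinity>\<close>.\<close>
lemma Borell_Brascamp_Lieb_real:
  fixes u v w :: "real \<Rightarrow> ennreal" and e :: real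
  assumes [measurable]: "u \<in> borel_measurable borel" "v \<in> borel_measurable borel"
      "w \<in> borel_measurable borel"
    and e: "e > 1"
    and H: "\<And>x y. \<exists>l\<in>{0..1}. ennreal (l powr e) * u x + ennreal ((1 - l) powr e) * v y \<le> w (x + y)"
  shows "\<exists>l\<in>{0..1}. ennreal (l powr (e - 1)) * (\<integral>\<^sup>+x. u x \<partial>lborel)
    + ennreal ((1 - l) powr (e - 1)) * (\<integral>\<^sup>+x. v x \<partial>lborel) \<le> (\<integral>\<^sup>+x. w x \<partial>lborel)"
proof -
  let ?U = "\<integral>\<^sup>+x. u x \<partial>lborel" and ?V = "\<integral>\<^sup>+x. v x \<partial>lborel" and ?W = "\<integral>\<^sup>+x. w x \<partial>lborel"
  have Hs: "\<exists>l\<in>{0..1}. ennreal (l powr e) * v x + ennreal ((1 - l) powr e) * u y \<le> w (x + y)" for x y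
  proof -
    obtain l where "l \<in> {0..1}" "ennreal (l powr e) * u y + ennreal ((1 - l) powr e) * v x \<le> w (y + x)"
      using H[of y x] by auto
    then show ?thesis by (intro bexI[of _ "1 - l"]) (auto simp: add.commute)
  qed
  \<comment> \<open>In the four degenerate cases an extreme weight works:
    \<open>0 powr (e - 1) = 0\<close> removes one integral, even an infinite one, and the other is
    either bounded by that of \<open>w\<close> or zero.\<close>
  consider "(SUP x. u x) = \<infinity>" | "(SUP x. v x) = \<infinity>" | "(SUP x. u x) = 0" | "(SUP x. v x) = 0"
    | "(SUP x. u x) \<noteq> \<infinity>" "(SUP x. v x) \<noteq> \<infinity>" "(SUP x. u x) \<noteq> 0" "(SUP x. v x) \<noteq> 0" by blast
  then show ?thesis
  proof cases
    case 1
    then have "?V \<le> ?W" using e H by (intro nn_integral_le_of_unbounded_summand[of v w e u]) auto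
    then show ?thesis by (intro bexI[of _ 0]) auto
  next
    case 2
    then have "?U \<le> ?W" using e Hs by (intro nn_integral_le_of_unbounded_summand[of u w e v]) auto
    then show ?thesis by (intro bexI[of _ 1]) auto
  next
    case 3
    then have "u x = 0" for x by (metis SUP_upper UNIV_I le_zero_eq)
    then show ?thesis by (intro bexI[of _ 1]) auto
  next
    case 4
    then have "v x = 0" for x by (metis SUP_upper UNIV_I le_zero_eq)
    then show ?thesis by (intro bexI[of _ 0]) auto
  next
    case 5
    obtain a where a: "(SUP x. u x) = ennreal a" "a > 0"
      using 5 by (cases "SUP x. u x") (auto simp: less_le)
    obtain b where b: "(SUP x. v x) = ennreal b" "b > 0"
      using 5 by (cases "SUP x. v x") (auto simp: less_le)
    have ua: "u x \<le> ennreal a" for x using SUP_upper[of x UNIV u] a by simp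
    have vb: "v x \<le> ennreal b" for x using SUP_upper[of x UNIV v] b by simp
    \<comment> \<open>The weight \<open>l\<close> equalises the two suprema:
      \<open>l powr (e - 1) * a\<close> and \<open>(1 - l) powr (e - 1) * b\<close> are both
      \<open>m\<close>. This common factor lets the two layer cake integrals be added under one
      integral sign.\<close>
    define p where "p = a powr (- 1 / (e - 1))"
    define q where "q = b powr (- 1 / (e - 1))"
    define l where "l = p / (p + q)"
    define m where "m = (p + q) powr (1 - e)"
    have pq: "p > 0" "q > 0" using a b by (auto simp: p_def q_def)
    have l: "0 < l" "l < 1" "1 - l = q / (p + q)" using pq by (auto simp: l_def field_simps)
    have m: "m > 0" using pq by (simp add: m_def)
    note mn = weighted_powr_min[OF a(2) b(2) e, folded p_def q_def]
    have ma: "l powr (e - 1) * a = m" and mb: "(1 - l) powr (e - 1) * b = m"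
      using mn(1,2) l(3) by (auto simp: l_def m_def)
    let ?A = "\<lambda>s. {x. ennreal (a * s) \<le> u x}" and ?B = "\<lambda>s. {x. ennreal (b * s) \<le> v x}"
      and ?C = "\<lambda>s. {x. ennreal (m * s) \<le> w x}"
    \<comment> \<open>Heights proportional to the suprema keep both superlevel sets nonempty for
      \<open>s < 1\<close>, as Brunn-Minkowski demands. Minimality of \<open>m\<close> over all
      weights puts the sums of their points into the level set of \<open>w\<close> at height
      \<open>m * s\<close>.\<close>
    have bm: "emeasure lborel (?A s) + emeasure lborel (?B s) \<le> emeasure lborel (?C s)"
      if s: "0 < s" "s < 1" for s
    proof (rule brunn_minkowski_real)
      have "ennreal (a * s) < (SUP x. u x)" using a s by (simp add: ennreal_less_iff)
      then show "?A s \<noteq> {}" by (auto simp: less_SUP_iff intro: less_imp_le)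
      have "ennreal (b * s) < (SUP x. v x)" using b s by (simp add: ennreal_less_iff)
      then show "?B s \<noteq> {}" by (auto simp: less_SUP_iff intro: less_imp_le)
    next
      fix x y assume xy: "x \<in> ?A s" "y \<in> ?B s"
      obtain t where t: "0 \<le> t" "t \<le> 1"
        and w: "ennreal (t powr e) * u x + ennreal ((1 - t) powr e) * v y \<le> w (x + y)"
        using H[of x y] by auto
      have "m * s \<le> (t powr e * a + (1 - t) powr e * b) * s"
        using mn(3)[OF t] s by (intro mult_right_mono) (auto simp: m_def)
      then have "ennreal (m * s) \<le> ennreal (t powr e * (a * s) + (1 - t) powr e * (b * s))"
        by (intro ennreal_leI) (simp add: algebra_simps)
      also have "\<dots> = ennreal (t powr e) * ennreal (a * s) + ennreal ((1 - t) powr e) * ennreal (b * s)"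
        using a b s by (simp add: ennreal_mult ennreal_plus)
      also have "\<dots> \<le> ennreal (t powr e) * u x + ennreal ((1 - t) powr e) * v y"
        using xy by (intro add_mono mult_left_mono) auto
      finally show "x + y \<in> ?C s" using w by simp
    qed measurable
    have lc: "(\<integral>\<^sup>+x. min (g x) (ennreal c) \<partial>lborel) =
        ennreal c * (\<integral>\<^sup>+s\<in>{0<..<1}. emeasure lborel {x. ennreal (c * s) \<le> g x} \<partial>lborel)"
      if "g \<in> borel_measurable borel" "0 < c" for c and g :: "real \<Rightarrow> ennreal"
      using nn_integral_min_layer_cake[OF lborel.sigma_finite_measure_axioms, of g c] that by simp
    have U: "?U = ennreal a * (\<integral>\<^sup>+s\<in>{0<..<1}. emeasure lborel (?A s) \<partial>lborel)"
      using lc[of u a] a ua by (simp add: min_absorb1)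
    have V: "?V = ennreal b * (\<integral>\<^sup>+s\<in>{0<..<1}. emeasure lborel (?B s) \<partial>lborel)"
      using lc[of v b] b vb by (simp add: min_absorb1)
    have level_meas: "(\<lambda>s. emeasure lborel {x. ennreal (c * s) \<le> g x}) \<in> borel_measurable lborel"
      if [measurable]: "g \<in> borel_measurable borel" for c :: real and g :: "real \<Rightarrow> ennreal"
    proof -
      have "{z\<in>space (borel \<Otimes>\<^sub>M borel). ennreal (c * fst z) \<le> g (snd z)} \<in> sets (borel \<Otimes>\<^sub>M borel)"
        by measurable
      then have "{z. ennreal (c * fst z) \<le> g (snd z)} \<in> sets (lborel \<Otimes>\<^sub>M lborel :: (real \<times> real) measure)"
        by (simp add: space_pair_measure cong: sets_pair_measure_cong)
      from lborel.measurable_emeasure_Pair[OF this] show ?thesis by (simp add: vimage_def)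
    qed
    have restr_meas: "(\<lambda>s. emeasure lborel {x. ennreal (c * s) \<le> g x} * indicator {0<..<1} s) \<in> borel_measurable lborel"
      if "g \<in> borel_measurable borel" for c :: real and g :: "real \<Rightarrow> ennreal"
      using level_meas[OF that] by (rule borel_measurable_times_ennreal) simp
    have "ennreal (l powr (e - 1)) * ?U + ennreal ((1 - l) powr (e - 1)) * ?V =
      ennreal m * ((\<integral>\<^sup>+s\<in>{0<..<1}. emeasure lborel (?A s) \<partial>lborel) + (\<integral>\<^sup>+s\<in>{0<..<1}. emeasure lborel (?B s) \<partial>lborel))"
    proof -
      have "ennreal (l powr (e - 1)) * ennreal a = ennreal m"
        "ennreal ((1 - l) powr (e - 1)) * ennreal b = ennreal m"
        using a b ma mb by (simp_all flip: ennreal_mult)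
      then show ?thesis by (simp only: U V mult.assoc[symmetric] distrib_left)
    qed
    also have "\<dots> = ennreal m * (\<integral>\<^sup>+s\<in>{0<..<1}. (emeasure lborel (?A s) + emeasure lborel (?B s)) \<partial>lborel)"
      using nn_integral_add[OF restr_meas[OF assms(1), of a] restr_meas[OF assms(2), of b]]
      by (simp only: distrib_right)
    also have "\<dots> \<le> ennreal m * (\<integral>\<^sup>+s\<in>{0<..<1}. emeasure lborel (?C s) \<partial>lborel)"
      using bm by (intro mult_left_mono nn_integral_mono) (auto simp: indicator_def)
    also have "\<dots> = (\<integral>\<^sup>+x. min (w x) (ennreal m) \<partial>lborel)"
      using lc[of w m] m by simp
    also have "\<dots> \<le> ?W" by (intro nn_integral_mono) auto
    finally show ?thesis using l by (intro bexI[of _ l]) auto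
  qed
qed

section \<open>Higher dimensions by induction over the coordinates\<close>

lemma Borell_Brascamp_Lieb_PiM:
  fixes u v w :: "('i \<Rightarrow> real) \<Rightarrow> ennreal" and e :: real
  assumes "finite I"
    and "u \<in> borel_measurable (\<Pi>\<^sub>M i\<in>I. lborel)" "v \<in> borel_measurable (\<Pi>\<^sub>M i\<in>I. lborel)"
      "w \<in> borel_measurable (\<Pi>\<^sub>M i\<in>I. lborel)"
    and "e > card I"
    and "\<And>x y. x \<in> extensional I \<Longrightarrow> y \<in> extensional I \<Longrightarrow>
      \<exists>l\<in>{0..1}. ennreal (l powr e) * u x + ennreal ((1 - l) powr e) * v y \<le> w (\<lambda>i\<in>I. x i + y i)"
  shows "\<exists>l\<in>{0..1}. ennreal (l powr (e - card I)) * (\<integral>\<^sup>+x. u x \<partial>(\<Pi>\<^sub>M i\<in>I. lborel))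
    + ennreal ((1 - l) powr (e - card I)) * (\<integral>\<^sup>+x. v x \<partial>(\<Pi>\<^sub>M i\<in>I. lborel))
    \<le> (\<integral>\<^sup>+x. w x \<partial>(\<Pi>\<^sub>M i\<in>I. lborel))"
  using assms
proof (induction I arbitrary: u v w e rule: finite_induct)
  case empty
  interpret product_sigma_finite "\<lambda>_. lborel :: real measure" by standard
  from empty(5)[of "\<lambda>_. undefined" "\<lambda>_. undefined"] show ?case
    by (simp add: PiM_empty nn_integral_count_space_finite restrict_def)
next
  case (insert i I)
  interpret product_sigma_finite "\<lambda>_. lborel :: real measure" by standard
  let ?M = "\<Pi>\<^sub>M i\<in>I. (lborel :: real measure)" and ?N = "\<Pi>\<^sub>M i\<in>insert i I. (lborel :: real measure)"
  define slice where "slice f x = (\<integral>\<^sup>+s. f (x(i := s)) \<partial>lborel)"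
    for f :: "('i \<Rightarrow> real) \<Rightarrow> ennreal" and x
  have integral_slice: "(\<integral>\<^sup>+x. f x \<partial>?N) = (\<integral>\<^sup>+x. slice f x \<partial>?M)" if "f \<in> borel_measurable ?N" for f
    unfolding slice_def using insert(1,2) that by (rule product_nn_integral_insert)
  have slice_meas: "slice f \<in> borel_measurable ?M"
    if [measurable]: "f \<in> borel_measurable ?N" for f
    unfolding slice_def by measurable
  have section_meas: "(\<lambda>s. f (x(i := s))) \<in> borel_measurable borel"
    if "f \<in> borel_measurable ?N" "x \<in> extensional I" for f :: "('i \<Rightarrow> real) \<Rightarrow> ennreal" and x
  proof -
    have "(\<lambda>s. x(i := s)) \<in> measurable lborel ?N"
      using that(2) by (intro measurable_fun_upd[where J=I]) (auto simp: space_PiM PiE_def)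
    from measurable_compose[OF this that(1)] show ?thesis by simp
  qed
  \<comment> \<open>Integrating out coordinate \<open>i\<close> lowers the exponent by one: the
    one-dimensional inequality gives the slices the hypothesis with \<open>e - 1\<close>, which
    still exceeds \<open>card I\<close>, so the induction hypothesis applies to them.\<close>
  have card: "e - card (insert i I) = (e - 1) - card I" "e > 1" "e - 1 > card I"
    using insert.hyps insert.prems(4) by auto
  have "\<exists>l\<in>{0..1}. ennreal (l powr (e - 1)) * slice u x + ennreal ((1 - l) powr (e - 1)) * slice v y
      \<le> slice w (\<lambda>i\<in>I. x i + y i)"
    if x: "x \<in> extensional I" and y: "y \<in> extensional I" for x y
    unfolding slice_def
  proof (rule Borell_Brascamp_Lieb_real)
    fix s t :: real
    have "(\<lambda>j\<in>insert i I. (x(i := s)) j + (y(i := t)) j) = (\<lambda>j\<in>I. x j + y j)(i := s + t)"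
      using insert.hyps by (auto simp: fun_eq_iff)
    moreover have "x(i := s) \<in> extensional (insert i I)" "y(i := t) \<in> extensional (insert i I)"
      using x y by (auto simp: extensional_def)
    ultimately show "\<exists>l\<in>{0..1}. ennreal (l powr e) * u (x(i := s)) + ennreal ((1 - l) powr e) * v (y(i := t))
        \<le> w ((\<lambda>i\<in>I. x i + y i)(i := s + t))"
      using insert.prems(5)[of "x(i := s)" "y(i := t)"] by metis
  qed (use x y card section_meas insert.prems in auto)
  from insert.IH[OF slice_meas slice_meas slice_meas card(3) this,
      OF insert.prems(1-3)]
  show ?case
    unfolding card(1) integral_slice[OF insert.prems(1)] integral_slice[OF insert.prems(2)]
      integral_slice[OF insert.prems(3)] .
qed

theorem Borell_Brascamp_Lieb:
  fixes u v w :: "'a::euclidean_space \<Rightarrow> ennreal" and e :: real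
  assumes [measurable]: "u \<in> borel_measurable borel" "v \<in> borel_measurable borel"
      "w \<in> borel_measurable borel"
    and e: "e > DIM('a)"
    and H: "\<And>x y. \<exists>l\<in>{0..1}. ennreal (l powr e) * u x + ennreal ((1 - l) powr e) * v y \<le> w (x + y)"
  shows "\<exists>l\<in>{0..1}. ennreal (l powr (e - DIM('a))) * (\<integral>\<^sup>+x. u x \<partial>lborel)
    + ennreal ((1 - l) powr (e - DIM('a))) * (\<integral>\<^sup>+x. v x \<partial>lborel) \<le> (\<integral>\<^sup>+x. w x \<partial>lborel)"
proof -
  let ?P = "\<Pi>\<^sub>M b\<in>(Basis :: 'a set). (lborel :: real measure)"
  let ?T = "\<lambda>x. \<Sum>b\<in>(Basis :: 'a set). x b *\<^sub>R b"
  have T[measurable]: "?T \<in> measurable ?P borel" by measurable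
  have int: "(\<integral>\<^sup>+x. f x \<partial>lborel) = (\<integral>\<^sup>+x. f (?T x) \<partial>?P)"
    if [measurable]: "f \<in> borel_measurable borel" for f :: "'a \<Rightarrow> ennreal"
    by (subst lborel_eq) (simp add: nn_integral_distr)
  have T_add: "?T (\<lambda>b\<in>Basis. x b + y b) = ?T x + ?T y" for x y
    by (simp add: sum.distrib scaleR_left_distrib)
  have "\<exists>l\<in>{0..1}. ennreal (l powr e) * u (?T x) + ennreal ((1 - l) powr e) * v (?T y)
      \<le> w (?T (\<lambda>b\<in>Basis. x b + y b))" for x y
    unfolding T_add by (rule H)
  then show ?thesis
    unfolding int[OF assms(1)] int[OF assms(2)] int[OF assms(3)] using e
    by (intro Borell_Brascamp_Lieb_PiM) auto
qed

section \<open>Negative powers of integrals\<close>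

text \<open>The power \<open>t^(-1/c)\<close>, with the value \<open>0\<close> at \<open>t = \<infinity>\<close>; since \<open>0 powr p = 0\<close> in HOL,
  the value at \<open>t = 0\<close> is junk.\<close>
definition npow :: "real \<Rightarrow> ennreal \<Rightarrow> real" where
  "npow c t = (if t = \<infinity> then 0 else enn2real t powr (- 1 / c))"

lemma npow_nonneg: "npow c t \<ge> 0"
  by (simp add: npow_def)

lemma npow_ennreal: "r \<ge> 0 \<Longrightarrow> npow c (ennreal r) = r powr (- 1 / c)"
  by (simp add: npow_def)

lemma npow_cmult:
  assumes "r > 0"
  shows "npow c (ennreal r * t) = r powr (- 1 / c) * npow c t"
  using assms by (cases t) (auto simp: npow_def ennreal_mult_top ennreal_mult[symmetric] powr_mult)

lemma npow_antimono:
  assumes "0 < s" "s \<le> t" "c > 0"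
  shows "npow c t \<le> npow c s"
proof (cases "t = \<infinity>")
  case False
  then have "t < \<infinity>" "s < \<infinity>" using assms(2) by (auto simp: less_top[symmetric] top_unique)
  then have "0 < enn2real s" "enn2real s \<le> enn2real t"
    using assms by (auto simp: enn2real_positive_iff intro: enn2real_mono)
  then show ?thesis
    using False \<open>s < \<infinity>\<close> assms(3) by (auto simp: npow_def intro!: powr_mono2')
qed (auto simp: npow_def)

text \<open>Whatever the weight \<open>l\<close>, the left side of the assumption on
  \<open>W\<close> is at least \<open>(npow c U + npow c V) powr (- c)\<close>, by
  \<open>weighted_powr_min\<close> with exponent \<open>1 + c\<close>. Positivity of
  \<open>W\<close> is recorded because \<open>npow\<close> has a junk value at 0.\<close>

lemma npow_subadditive:
  fixes U V W :: ennreal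
  assumes c: "c > 0" and U: "0 < U" and V: "0 < V" and l: "l \<in> {0..1}"
    and W: "ennreal (l powr (1 + c)) * U + ennreal ((1 - l) powr (1 + c)) * V \<le> W"
  shows "W > 0" and "npow c W \<le> npow c U + npow c V"
proof -
  have pos: "ennreal (l powr (1 + c)) * U + ennreal ((1 - l) powr (1 + c)) * V > 0"
    using U V l by (cases "l = 0") (auto simp: add_pos_nonneg ennreal_zero_less_mult_iff)
  then show W0: "W > 0" using W by (rule less_le_trans)
  \<comment> \<open>An infinite \<open>Y\<close> forces \<open>W\<close> to be infinite, hence
    \<open>npow c W = 0\<close>, unless its weight vanishes; then \<open>t = 1\<close> and
    \<open>W\<close> dominates \<open>X\<close>.\<close>
  have one: "npow c W \<le> npow c X + npow c Y"
    if "Y = \<infinity>" and X: "0 < X" and t: "t \<in> {0..1}"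
      and W: "ennreal (t powr (1 + c)) * X + ennreal ((1 - t) powr (1 + c)) * Y \<le> W" for X Y t
  proof (cases "t = 1")
    case True
    then have "X \<le> W" using W by simp
    then show ?thesis using npow_antimono[OF X _ c, of W] npow_nonneg[of c Y] by simp
  next
    case False
    then have "(1 - t) powr (1 + c) > 0" using t by auto
    then have "W = \<infinity>" using W that(1) by (simp add: ennreal_mult_top top_unique)
    then show ?thesis using npow_nonneg[of c X] npow_nonneg[of c Y] by (simp add: npow_def)
  qed
  show "npow c W \<le> npow c U + npow c V"
  proof (cases "U = \<infinity> \<or> V = \<infinity>")
    case True
    then show ?thesis
      using one[OF _ U l W] one[OF _ V, of U "1 - l"] W l by (auto simp: add.commute)
  next
    case False
    then obtain a b where ab: "U = ennreal a" "a > 0" "V = ennreal b" "b > 0"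
      using U V by (cases U; cases V) (auto simp: less_le)
    define p where "p = a powr (- 1 / c)"
    define q where "q = b powr (- 1 / c)"
    have pq: "p > 0" "q > 0" using ab by (auto simp: p_def q_def)
    have "(p + q) powr (- c) \<le> l powr (1 + c) * a + (1 - l) powr (1 + c) * b"
      using weighted_powr_min(3)[OF ab(2,4), of "1 + c" l] c l by (simp add: p_def q_def)
    then have "ennreal ((p + q) powr (- c)) \<le> W"
      using W ab by (simp add: ennreal_mult[symmetric] ennreal_plus[symmetric] del: ennreal_plus)
        (meson ennreal_leI order_trans)
    then have "npow c W \<le> npow c (ennreal ((p + q) powr (- c)))"
      using pq c by (intro npow_antimono) auto
    also have "\<dots> = p + q"
      using pq c by (simp add: npow_ennreal powr_powr)
    finally show ?thesis using ab by (simp add: npow_ennreal p_def q_def)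
  qed
qed

lemma nn_integral_lborel_scale:
  fixes g :: "'a::euclidean_space \<Rightarrow> ennreal"
  assumes [measurable]: "g \<in> borel_measurable borel" and c: "c > 0"
  shows "(\<integral>\<^sup>+x. g ((1 / c) *\<^sub>R x) \<partial>lborel) = ennreal (c ^ DIM('a)) * (\<integral>\<^sup>+x. g x \<partial>lborel)"
proof -
  have "(\<integral>\<^sup>+x. g ((1 / c) *\<^sub>R x) \<partial>lborel) =
    (\<integral>\<^sup>+x. g ((1 / c) *\<^sub>R x) \<partial>density (distr lborel borel (\<lambda>x. 0 + c *\<^sub>R x)) (\<lambda>_. \<bar>c\<bar> ^ DIM('a)))"
    using lborel_affine[of c "0::'a"] c by simp
  also have "\<dots> = ennreal (c ^ DIM('a)) * (\<integral>\<^sup>+x. g x \<partial>lborel)"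
    using c by (simp add: nn_integral_density nn_integral_distr nn_integral_cmult)
  finally show ?thesis .
qed

section \<open>One-sided difference quotients through the negative power\<close>

lemma powr_neg_Bernoulli:
  fixes t c :: real
  assumes "t > 0" "c > 0"
  shows "1 - c * (t - 1) \<le> t powr (- c)"
proof -
  have "c * ln t \<le> c * (t - 1)" using assms ln_le_minus_one by (intro mult_left_mono) auto
  then have "1 - c * (t - 1) \<le> 1 + (- c * ln t)" by simp
  also have "\<dots> \<le> exp (- c * ln t)" by (rule exp_ge_add_one_self)
  finally show ?thesis using assms by (simp add: powr_def)
qed

text \<open>A positive value of \<open>npow\<close> excludes both \<open>t = \<infinity>\<close> and
  \<open>t = 0\<close>, so the power can be inverted.\<close>

lemma ennreal_eq_npow:
  assumes "c > 0" "npow c t > 0"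
  shows "t = ennreal (npow c t powr (- c))"
proof (cases t)
  case (real r)
  then have "r \<noteq> 0" using assms by (auto simp: npow_def)
  then show ?thesis using real assms by (simp add: npow_ennreal powr_powr)
qed (use assms in \<open>simp add: npow_def\<close>)

lemma npow_eq_0_imp:
  assumes "t > 0" "npow c t = 0"
  shows "t = \<infinity>"
  using assms by (cases t) (auto simp: npow_ennreal)

text \<open>The chord inequality makes the quotients \<open>D\<close> of \<open>npow c (F t)\<close>
  monotone in \<open>t\<close>, so they converge to their infimum \<open>d\<close> or to minus
  infinity. In the first case the chain rule for the power \<open>-c\<close> gives the limit
  \<open>- A * d\<close>, where \<open>- A\<close> is the derivative of that power at
  \<open>P0\<close>, and the bound \<open>upper\<close> gives
  \<open>d \<le> - \<theta> * P0 + K\<close>. In the second case the limit is plus infinity; this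
  includes infinite \<open>F t\<close>.\<close>

lemma right_quotient_limit:
  fixes F :: "real \<Rightarrow> ennreal" and c j K \<theta> :: real
  defines "P0 \<equiv> npow c (ennreal j)"
  assumes c: "c > 0" and j: "j > 0"
    and pos: "\<And>t. 0 < t \<Longrightarrow> t < 1 \<Longrightarrow> F t > 0"
    and conv: "\<And>s t. 0 < s \<Longrightarrow> s < 1 \<Longrightarrow> 0 < t \<Longrightarrow> t < 1 \<Longrightarrow>
      npow c (F (s * t)) \<le> (1 - s) * P0 + s * npow c (F t)"
    and upper: "\<And>t. 0 < t \<Longrightarrow> t < 1 \<Longrightarrow> npow c (F t) \<le> (1 - t) powr \<theta> * P0 + t * K"
  obtains L where "((\<lambda>t. (enn2ereal (F t) - ereal j) * ereal (1 / t)) \<longlongrightarrow> L) (at_right 0)"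
    and "ereal (c * j powr (1 + 1 / c) * (\<theta> * P0 - K)) \<le> L"
proof -
  define P where "P t = npow c (F t)" for t
  define D where "D t = (P t - P0) / t" for t
  define A where "A = c * j powr (1 + 1 / c)"
  have P0_eq: "P0 = j powr (- 1 / c)" using j by (simp add: P0_def npow_ennreal)
  have P0: "P0 > 0" using j by (simp add: P0_eq)
  have A: "A > 0" using c j by (simp add: A_def)
  have P0_c: "P0 powr (- c) = j" using c j by (simp add: P0_eq powr_powr)
  have "- 1 / c * (- c - 1) = 1 + 1 / c" using c by (simp add: field_simps)
  then have A_eq: "c * P0 powr (- c - 1) = A"
    unfolding P0_eq powr_powr A_def by simp
  have mono: "D s \<le> D t" if "0 < s" "s < t" "t < 1" for s t
  proof -
    have "P (s / t * t) \<le> (1 - s / t) * P0 + s / t * P t"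
      unfolding P_def using that by (intro conv) auto
    then have "P s - P0 \<le> s / t * (P t - P0)" using that by (simp add: algebra_simps)
    then have "(P s - P0) / s \<le> s / t * (P t - P0) / s" using that by (intro divide_right_mono) auto
    then show ?thesis using that by (simp add: D_def)
  qed
  have small: "\<forall>\<^sub>F t in at_right 0. D t < r" if "0 < s" "s < 1" "D s < r" for r s
    using eventually_at_right_real[OF that(1)]
  proof eventually_elim
    case (elim t)
    then show ?case using mono[of t s] that by auto
  qed
  have ev01: "\<forall>\<^sub>F t in at_right (0::real). t \<in> {0<..<1}"
    by (rule eventually_at_right_real) simp
  show thesis
  proof (cases "bdd_below (D ` {0<..<1})")
    case True
    define d where "d = Inf (D ` {0<..<1})"
    have D_lim: "(D \<longlongrightarrow> d) (at_right 0)"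
    proof (rule order_tendstoI)
      fix a assume "a < d"
      show "\<forall>\<^sub>F t in at_right 0. a < D t"
        using ev01
      proof eventually_elim
        case (elim t)
        then have "d \<le> D t" unfolding d_def by (intro cInf_lower True) auto
        then show ?case using \<open>a < d\<close> by simp
      qed
    next
      fix a assume "d < a"
      then obtain s where "s \<in> {0<..<1}" "D s < a"
        unfolding d_def by (subst (asm) cInf_less_iff[OF _ True]) auto
      then show "\<forall>\<^sub>F t in at_right 0. D t < a" by (intro small[of s]) auto
    qed
    have "((\<lambda>t. (1 - t) powr \<theta>) has_real_derivative - \<theta>) (at 0 within {0<..})"
      by (rule has_field_derivative_at_within) (auto intro!: derivative_eq_intros)
    then have "((\<lambda>t. ((1 - t) powr \<theta> - 1) / t) \<longlongrightarrow> - \<theta>) (at_right 0)"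
      by (simp add: has_field_derivative_iff)
    then have "((\<lambda>t. ((1 - t) powr \<theta> - 1) / t * P0 + K) \<longlongrightarrow> - \<theta> * P0 + K) (at_right 0)"
      by (intro tendsto_intros)
    moreover have "\<forall>\<^sub>F t in at_right 0. D t \<le> ((1 - t) powr \<theta> - 1) / t * P0 + K"
      using ev01
    proof eventually_elim
      case (elim t)
      then have "P t \<le> (1 - t) powr \<theta> * P0 + t * K" unfolding P_def by (intro upper) auto
      then show ?case using elim by (simp add: D_def field_simps)
    qed
    ultimately have d_le: "d \<le> - \<theta> * P0 + K"
      by (rule tendsto_le[OF trivial_limit_at_right_real _ D_lim])
    \<comment> \<open>The value at 0 is set by hand to \<open>P0\<close>, since no assumption
      concerns \<open>F 0\<close>; convergence of \<open>D\<close> then becomes differentiability of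
      \<open>p\<close> at 0 from the right.\<close>
    define p where "p t = (if t = 0 then P0 else P t)" for t
    have p_deriv: "(p has_real_derivative d) (at 0 within {0<..})"
      unfolding has_field_derivative_iff
      by (rule Lim_transform_eventually[OF D_lim])
         (auto simp: D_def p_def intro: eventually_mono[OF ev01])
    have "((\<lambda>y. y powr (- c)) has_real_derivative - A) (at (p 0))"
      using P0 by (auto intro!: derivative_eq_intros simp: p_def A_eq[symmetric])
    from DERIV_chain'[OF p_deriv this] have q_lim: "((\<lambda>t. (p t powr (- c) - j) / t) \<longlongrightarrow> - A * d) (at_right 0)"
      by (simp add: has_field_derivative_iff p_def P0_c)
    have "(p \<longlongrightarrow> p 0) (at_right 0)"
      using p_deriv has_field_derivative_imp_has_derivative has_derivative_continuous
      by (fastforce simp: continuous_within)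
    moreover have "0 < p 0" using P0 by (simp add: p_def)
    ultimately have "\<forall>\<^sub>F t in at_right 0. 0 < p t" by (rule order_tendstoD(1))
    then have "\<forall>\<^sub>F t in at_right 0. ereal ((p t powr (- c) - j) / t) = (enn2ereal (F t) - ereal j) * ereal (1 / t)"
      using ev01
    proof eventually_elim
      case (elim t)
      then have "F t = ennreal (p t powr (- c))"
        using ennreal_eq_npow[OF c, of "F t"] by (auto simp: p_def P_def)
      then show ?case by (simp add: enn2ereal_ennreal)
    qed
    then have "((\<lambda>t. (enn2ereal (F t) - ereal j) * ereal (1 / t)) \<longlongrightarrow> ereal (- A * d)) (at_right 0)"
      by (rule Lim_transform_eventually[rotated]) (use q_lim in simp)
    moreover have "A * (\<theta> * P0 - K) \<le> - A * d"
      using d_le A mult_left_mono[of d "- \<theta> * P0 + K" A] by (simp add: algebra_simps)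
    ultimately show thesis by (intro that) (auto simp: A_def)
  next
    case False
    \<comment> \<open>Either \<open>F t\<close> is infinite, or the tangent of the convex power
      \<open>-c\<close> at \<open>P0\<close> bounds the quotient of \<open>F\<close> below by
      \<open>- A * D t\<close>, which becomes arbitrarily large.\<close>
    have "((\<lambda>t. (enn2ereal (F t) - ereal j) * ereal (1 / t)) \<longlongrightarrow> \<infinity>) (at_right 0)"
      unfolding tendsto_PInfty
    proof
      fix r :: real
      have "\<exists>s\<in>{0<..<1}. D s < - r / A"
        using False unfolding bdd_below_def by (force simp: not_le)
      then obtain s where "0 < s" "s < 1" "D s < - r / A" by auto
      from small[OF this] show "\<forall>\<^sub>F t in at_right 0. ereal r < (enn2ereal (F t) - ereal j) * ereal (1 / t)"
        using ev01
      proof eventually_elim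
        case (elim t)
        show ?case
        proof (cases "P t = 0")
          case True
          then have "F t = \<infinity>" using npow_eq_0_imp pos elim unfolding P_def by auto
          then show ?thesis using elim by simp
        next
          case nz: False
          then have Pt: "P t > 0" using npow_nonneg[of c "F t"] by (auto simp: P_def less_le)
          have F: "F t = ennreal (P t powr (- c))"
            using ennreal_eq_npow[OF c] Pt by (simp add: P_def)
          have "1 - c * (P t / P0 - 1) \<le> (P t / P0) powr (- c)"
            using Pt P0 c by (intro powr_neg_Bernoulli) auto
          also have "\<dots> = P t powr (- c) / j" using Pt P0 by (simp add: powr_divide P0_c)
          finally have "j - c * j / P0 * (P t - P0) \<le> P t powr (- c)"
            using j P0 by (simp add: field_simps)
          moreover have "c * j / P0 = A"
            unfolding A_eq[symmetric] powr_diff P0_c using P0 by simp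
          ultimately have "- A * (P t - P0) \<le> P t powr (- c) - j" by simp
          then have "- A * (P t - P0) / t \<le> (P t powr (- c) - j) / t"
            using elim by (intro divide_right_mono) auto
          moreover have "r < - A * D t" using elim A by (simp add: field_simps)
          ultimately have "r < (P t powr (- c) - j) / t" by (simp add: D_def)
          then show ?thesis by (simp add: F enn2ereal_ennreal)
        qed
      qed
    qed
    then show thesis by (intro that) auto
  qed
qed

section \<open>Finiteness of the integral of the Gaussian analogue\<close>

lemma nn_integral_inverse_1_plus_square_finite:
  "(\<integral>\<^sup>+x. ennreal (inverse (1 + x\<^sup>2)) \<partial>(lborel :: real measure)) < \<infinity>"
proof -
  have "integrable lborel (\<lambda>x::real. inverse (1 + x\<^sup>2))"
    using integrable_inverse_1_plus_square by (simp add: set_integrable_def einterval_def)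
  then show ?thesis
    by (subst nn_integral_eq_integral) auto
qed

text \<open>The base is at least 1 and \<open>b\<close> exceeds the dimension n, so the power
  \<open>-b\<close> is at most the power \<open>-n\<close>. Each of the n factors is bounded through
  a single coordinate, leaving a product of one-dimensional Cauchy profiles.\<close>

lemma nn_integral_Student_finite:
  fixes b :: real
  assumes b: "b > DIM('a::euclidean_space)"
  shows "(\<integral>\<^sup>+x. ennreal ((1 + norm (x::'a) ^ 2 / (2 * b)) powr (- b)) \<partial>lborel) < \<infinity>"
proof -
  have b0: "b > 0" using b by (simp add: less_trans[OF _ b])
  have "(1 + norm x ^ 2 / (2 * b)) powr (- b) \<le> (\<Prod>i\<in>Basis. inverse (1 + (x \<bullet> i)\<^sup>2 / (2 * b)))" for x :: 'a
  proof -
    let ?S = "1 + norm x ^ 2 / (2 * b)"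
    have S: "?S \<ge> 1" using b0 by simp
    have "?S powr (- b) \<le> ?S powr (- real DIM('a))"
      using S b by (intro powr_mono) auto
    also have "\<dots> = (\<Prod>i\<in>(Basis :: 'a set). inverse ?S)"
      using S by (simp add: powr_minus powr_realpow power_inverse)
    also have "\<dots> \<le> (\<Prod>i\<in>Basis. inverse (1 + (x \<bullet> i)\<^sup>2 / (2 * b)))"
    proof (intro prod_mono conjI)
      fix i :: 'a assume i: "i \<in> Basis"
      have "(x \<bullet> i)\<^sup>2 \<le> (norm x)\<^sup>2"
        using Basis_le_norm[OF i, of x] by (simp add: abs_le_square_iff[symmetric])
      then have "1 + (x \<bullet> i)\<^sup>2 / (2 * b) \<le> ?S" using b0 by (simp add: divide_right_mono)
      moreover have "1 + (x \<bullet> i)\<^sup>2 / (2 * b) > 0" using b0 by (simp add: add_pos_nonneg)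
      ultimately show "inverse ?S \<le> inverse (1 + (x \<bullet> i)\<^sup>2 / (2 * b))" by (rule le_imp_inverse_le)
      show "0 \<le> inverse ?S" using S by simp
    qed
    finally show ?thesis .
  qed
  then have "(\<integral>\<^sup>+x. ennreal ((1 + norm (x::'a) ^ 2 / (2 * b)) powr (- b)) \<partial>lborel)
      \<le> (\<integral>\<^sup>+x. (\<Prod>i\<in>(Basis :: 'a set). ennreal (inverse (1 + (x \<bullet> i)\<^sup>2 / (2 * b)))) \<partial>lborel)"
    using b0 by (intro nn_integral_mono) (simp add: prod_ennreal ennreal_leI)
  also have "\<dots> = (\<Prod>i\<in>(Basis :: 'a set). \<integral>\<^sup>+x. ennreal (inverse (1 + x\<^sup>2 / (2 * b))) \<partial>lborel)"
    by (rule nn_integral_lborel_prod) auto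
  also have "(\<integral>\<^sup>+x. ennreal (inverse (1 + x\<^sup>2 / (2 * b))) \<partial>(lborel :: real measure))
      = ennreal (sqrt (2 * b)) * (\<integral>\<^sup>+x. ennreal (inverse (1 + x\<^sup>2)) \<partial>(lborel :: real measure))"
    using nn_integral_lborel_scale[of "\<lambda>x::real. ennreal (inverse (1 + x\<^sup>2))" "sqrt (2 * b)"] b0
    by (simp add: power_divide)
  also have "(\<Prod>i\<in>(Basis :: 'a set). \<dots>) < \<infinity>"
    using nn_integral_inverse_1_plus_square_finite
    by (simp add: ennreal_mult_less_top power_less_top_ennreal)
  finally show ?thesis .
qed

section \<open>Perturbations of the Gaussian analogue\<close>

lemma usc_borel_measurable:
  assumes "usc f"
  shows "f \<in> borel_measurable borel"
proof -
  have "open {x. f x < t}" for t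
  proof (subst open_subopen, intro ballI)
    fix x assume "x \<in> {x. f x < t}"
    \<comment> \<open>The filter \<open>at x\<close> in \<open>usc\<close> omits \<open>x\<close>;
      the assumption \<open>f x < t\<close> supplies that point.\<close>
    then have "\<forall>\<^sub>F y in nhds x. f y < t"
      using assms by (auto simp: usc_def eventually_nhds_conv_at)
    then show "\<exists>T. open T \<and> x \<in> T \<and> T \<subseteq> {x. f x < t}"
      unfolding eventually_nhds by blast
  qed
  then show ?thesis by (auto simp: borel_measurable_iff_less)
qed

text \<open>\<open>pert b t f = 1 + base(G \<star> t \<cdot> f) / b\<close> for \<open>0 < t < 1\<close>, in the variable \<open>z\<close> for which
  \<open>t z\<close> is the second summand of the infimal convolution.\<close>
definition cost :: "real \<Rightarrow> real \<Rightarrow> ('a::euclidean_space \<Rightarrow> real) \<Rightarrow> 'a \<Rightarrow> 'a \<Rightarrow> real" where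
  "cost b t f x z = 1 - t + norm (x - t *\<^sub>R z) ^ 2 / (2 * b) + t * f z powr (-1 / b)"

definition pert :: "real \<Rightarrow> real \<Rightarrow> ('a::euclidean_space \<Rightarrow> real) \<Rightarrow> 'a \<Rightarrow> real" where
  "pert b t f x = (INF z\<in>{z. f z \<noteq> 0}. cost b t f x z)"

text \<open>Bounds the family below, so that the real \<open>INF\<close> in \<open>pert\<close> is a
  genuine infimum; for \<open>t < 1\<close> the bound is positive.\<close>

lemma cost_ge: "b > 0 \<Longrightarrow> t > 0 \<Longrightarrow> 1 - t \<le> cost b t f x z"
  by (simp add: cost_def)

lemma pert_le_cost: "b > 0 \<Longrightarrow> t > 0 \<Longrightarrow> f z \<noteq> 0 \<Longrightarrow> pert b t f x \<le> cost b t f x z"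
  unfolding pert_def by (rule cINF_lower) (auto intro!: bdd_belowI2 cost_ge)

lemma pert_greatest:
  assumes "f z0 \<noteq> 0" "\<And>z. f z \<noteq> 0 \<Longrightarrow> r \<le> cost b t f x z"
  shows "r \<le> pert b t f x"
  unfolding pert_def using assms by (intro cINF_greatest) auto

lemma pert_pos: "b > 0 \<Longrightarrow> 0 < t \<Longrightarrow> t < 1 \<Longrightarrow> f z0 \<noteq> 0 \<Longrightarrow> pert b t f x > 0"
  using pert_greatest[of f z0 "1 - t" b t x] cost_ge[of b t f x] by fastforce

text \<open>The infimum may run over uncountably many \<open>z\<close>, but \<open>cost\<close> is
  continuous in \<open>x\<close>, so strict sublevel sets are unions of open sets.\<close>

lemma pert_measurable:
  assumes "b > 0" "t > 0" "f z0 \<noteq> 0"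
  shows "pert b t f \<in> borel_measurable borel"
proof -
  have "{x. pert b t f x < r} = (\<Union>z\<in>{z. f z \<noteq> 0}. {x. cost b t f x z < r})" for r
    unfolding pert_def using assms
    by (subst cINF_less_iff) (auto intro!: bdd_belowI2 cost_ge)
  moreover have "open {x. cost b t f x z < r}" for r z
    unfolding cost_def by (intro open_Collect_less continuous_intros) (use assms in auto)
  ultimately have "open {x. pert b t f x < r}" for r by auto
  then show ?thesis by (auto simp: borel_measurable_iff_less)
qed

lemma base_G_alpha:
  assumes "b > 0"
  shows "base (- 1 / b) (G_alpha (- 1 / b)) x = ereal (norm x ^ 2 / 2)"
proof -
  have "1 + norm x ^ 2 / (2 * b) > 0" using assms by (simp add: add_pos_nonneg)
  then show ?thesis using assms by (simp add: base_def G_alpha_def powr_powr field_simps)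
qed

lemma base_alpha_scale:
  assumes b: "b > 0" and t: "0 < t" "t < 1"
  shows "base (- 1 / b) (alpha_scale (- 1 / b) t f) y =
    (if f ((1 / t) *\<^sub>R y) = 0 then \<infinity> else ereal (b * (t * f ((1 / t) *\<^sub>R y) powr (- 1 / b) - t)))"
proof (cases "f ((1 / t) *\<^sub>R y) = 0")
  case True
  then have "alpha_scale (- 1 / b) t f y = 0"
    using t by (simp add: alpha_scale_def base_def unbase_def)
  then show ?thesis using True by (simp add: base_def)
next
  case False
  let ?s = "f ((1 / t) *\<^sub>R y) powr (- 1 / b)"
  have "1 - t + t * ?s > 0" using t by (simp add: add_pos_nonneg)
  moreover have "alpha_scale (- 1 / b) t f y = (1 - t + t * ?s) powr (- b)"
  proof -
    have "alpha_scale (- 1 / b) t f y =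
        (1 + t * ((1 - ?s) / (- 1 / b)) / (- 1 / (- 1 / b))) powr (- (- 1 / (- 1 / b)))"
      using False by (simp only: alpha_scale_def base_def unbase_def if_False times_ereal.simps ereal.case)
    also have "- 1 / (- 1 / b) = b" by simp
    also have "1 + t * ((1 - ?s) / (- 1 / b)) / b = 1 - t + t * ?s" using b by (simp add: field_simps)
    finally show ?thesis .
  qed
  ultimately show ?thesis
    using False b by (simp add: base_def powr_powr field_simps)
qed

text \<open>The substitution \<open>y = x - t *\<^sub>R z\<close> identifies the finite terms of the
  infimal convolution with \<open>b * (cost b t f x z - 1)\<close>; points with
  \<open>f z = 0\<close> contribute infinite terms. The infimum is finite, being squeezed between
  \<open>pert\<close> and the cost of \<open>z0\<close>.\<close>

lemma alpha_sum_eq_pert: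
  assumes b: "b > 0" and t: "0 < t" "t < 1" and f: "f z0 \<noteq> 0"
  shows "alpha_sum (- 1 / b) (G_alpha (- 1 / b)) (alpha_scale (- 1 / b) t f) x = pert b t f x powr (- b)"
proof -
  let ?\<alpha> = "- 1 / b"
  let ?term = "\<lambda>y. base ?\<alpha> (G_alpha ?\<alpha>) y + base ?\<alpha> (alpha_scale ?\<alpha> t f) (x - y)"
  define L where "L = (INF y. ?term y)"
  have at: "?term (x - t *\<^sub>R z) = ereal (b * (cost b t f x z - 1))" if "f z \<noteq> 0" for z
    unfolding base_G_alpha[OF b] base_alpha_scale[OF b t] cost_def
    using that b t by (simp add: field_simps)
  have ge: "ereal (b * (pert b t f x - 1)) \<le> L"
    unfolding L_def
  proof (rule INF_greatest)
    fix y
    define z where "z = (1 / t) *\<^sub>R (x - y)"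
    have y: "y = x - t *\<^sub>R z" using t by (simp add: z_def)
    show "ereal (b * (pert b t f x - 1)) \<le> ?term y"
    proof (cases "f z = 0")
      case True
      then show ?thesis
        unfolding base_G_alpha[OF b] base_alpha_scale[OF b t] z_def by simp
    next
      case False
      then show ?thesis
        unfolding y at[OF False] using pert_le_cost[of b t f z x] b t by simp
    qed
  qed
  have le: "L \<le> ereal (b * (cost b t f x z - 1))" if "f z \<noteq> 0" for z
    unfolding at[OF that, symmetric] L_def by (rule INF_lower) simp
  from ge le[OF f] obtain l where l: "L = ereal l" by (cases L) auto
  have "l / b + 1 \<le> pert b t f x"
    using le b l f by (intro pert_greatest[of f z0]) (auto simp: field_simps)
  with ge l b have "l = b * (pert b t f x - 1)" by (auto simp: field_simps)
  then show ?thesis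
    using b unfolding alpha_sum_def infconv_def L_def[symmetric] l by (simp add: unbase_def)
qed

text \<open>Equality case of \<open>weighted_powr_min\<close> for \<open>e = 1 + b\<close> and the
  values \<open>A powr (- b)\<close>, \<open>B powr (- b)\<close>: it supplies the weight that the
  existential form of the inequality asks for.\<close>

lemma powr_neg_sum_weights:
  fixes A B b :: real
  assumes "A > 0" "B > 0"
  shows "(A / (A + B)) powr (1 + b) * A powr (- b) + (1 - A / (A + B)) powr (1 + b) * B powr (- b)
    = (A + B) powr (- b)"
proof -
  have *: "(r / (A + B)) powr (1 + b) * r powr (- b) = r / (A + B) * (A + B) powr (- b)" if "r > 0" for r
    using that assms by (simp add: powr_divide powr_add powr_minus field_simps)
  have "1 - A / (A + B) = B / (A + B)" using assms by (simp add: field_simps)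
  then have "(A / (A + B)) powr (1 + b) * A powr (- b) + (1 - A / (A + B)) powr (1 + b) * B powr (- b)
      = A / (A + B) * (A + B) powr (- b) + B / (A + B) * (A + B) powr (- b)"
    using *[OF assms(1)] *[OF assms(2)] by (simp only:)
  also have "\<dots> = (A / (A + B) + B / (A + B)) * (A + B) powr (- b)" by (simp only: distrib_right)
  also have "A / (A + B) + B / (A + B) = 1" using assms by (simp add: add_divide_distrib[symmetric])
  finally show ?thesis by simp
qed

text \<open>Borell-Brascamp-Lieb with exponent \<open>1 + b\<close>, phrased for the bases
  \<open>A\<close> and \<open>B\<close>. Integration leaves the exponent \<open>1 + (b - n)\<close>
  in dimension n, which is what \<open>npow_subadditive\<close> with \<open>c = b - n\<close> takes.
  Where \<open>v\<close> vanishes, the weight 0 makes the pointwise bound trivial.\<close>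

lemma npow_integral_subadditive:
  fixes u v w A B :: "'a::euclidean_space \<Rightarrow> real" and b :: real
  assumes meas: "u \<in> borel_measurable borel" "v \<in> borel_measurable borel" "w \<in> borel_measurable borel"
    and b: "b > DIM('a)"
    and u: "\<And>x. 0 < A x" "\<And>x. u x = A x powr (- b)"
    and v: "\<And>y. v y \<noteq> 0 \<Longrightarrow> 0 < B y" "\<And>y. v y \<noteq> 0 \<Longrightarrow> v y = B y powr (- b)"
    and w: "\<And>x y. v y \<noteq> 0 \<Longrightarrow> (A x + B y) powr (- b) \<le> w (x + y)"
    and pos: "0 < (\<integral>\<^sup>+x. ennreal (u x) \<partial>lborel)" "0 < (\<integral>\<^sup>+x. ennreal (v x) \<partial>lborel)"
  shows "0 < (\<integral>\<^sup>+x. ennreal (w x) \<partial>lborel) \<and>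
    npow (b - DIM('a)) (\<integral>\<^sup>+x. ennreal (w x) \<partial>lborel) \<le>
      npow (b - DIM('a)) (\<integral>\<^sup>+x. ennreal (u x) \<partial>lborel) + npow (b - DIM('a)) (\<integral>\<^sup>+x. ennreal (v x) \<partial>lborel)"
proof -
  have "\<exists>l\<in>{0..1}. ennreal (l powr (1 + b)) * ennreal (u x) + ennreal ((1 - l) powr (1 + b)) * ennreal (v y)
      \<le> ennreal (w (x + y))" for x y
  proof (cases "v y = 0")
    case True
    then show ?thesis by (intro bexI[of _ 0]) auto
  next
    case False
    define l where "l = A x / (A x + B y)"
    have "l powr (1 + b) * u x + (1 - l) powr (1 + b) * v y \<le> w (x + y)"
      using powr_neg_sum_weights[of "A x" "B y" b] u v(1)[OF False] v(2)[OF False] w[OF False, of x]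
      by (simp add: l_def)
    then have "ennreal (l powr (1 + b)) * ennreal (u x) + ennreal ((1 - l) powr (1 + b)) * ennreal (v y)
      \<le> ennreal (w (x + y))"
      using u(2) v(2)[OF False]
      by (simp add: ennreal_mult[symmetric] ennreal_plus[symmetric] ennreal_leI del: ennreal_plus)
    moreover have "l \<in> {0..1}" using u(1)[of x] v(1)[OF False] by (simp add: l_def)
    ultimately show ?thesis by auto
  qed
  then have "\<exists>l\<in>{0..1}. ennreal (l powr (1 + b - DIM('a))) * (\<integral>\<^sup>+x. ennreal (u x) \<partial>lborel)
    + ennreal ((1 - l) powr (1 + b - DIM('a))) * (\<integral>\<^sup>+x. ennreal (v x) \<partial>lborel) \<le> (\<integral>\<^sup>+x. ennreal (w x) \<partial>lborel)"
    using meas b by (intro Borell_Brascamp_Lieb) auto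
  then obtain l where "l \<in> {0..1}"
    "ennreal (l powr (1 + (b - DIM('a)))) * (\<integral>\<^sup>+x. ennreal (u x) \<partial>lborel)
    + ennreal ((1 - l) powr (1 + (b - DIM('a)))) * (\<integral>\<^sup>+x. ennreal (v x) \<partial>lborel) \<le> (\<integral>\<^sup>+x. ennreal (w x) \<partial>lborel)"
    by (auto simp: add_diff_eq)
  then show ?thesis
    using npow_subadditive[of "b - DIM('a)" "\<integral>\<^sup>+x. ennreal (u x) \<partial>lborel" "\<integral>\<^sup>+x. ennreal (v x) \<partial>lborel" l]
      b pos by auto
qed

lemma nn_integral_scaled:
  fixes g :: "'a::euclidean_space \<Rightarrow> real"
  assumes g: "g \<in> borel_measurable borel" and s: "s > 0" and r: "r > 0"
  shows "(\<integral>\<^sup>+x. ennreal (r * g ((1 / s) *\<^sub>R x)) \<partial>lborel) =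
      ennreal (r * s ^ DIM('a)) * (\<integral>\<^sup>+x. ennreal (g x) \<partial>lborel)"
proof -
  note g[measurable]
  have "(\<integral>\<^sup>+x. ennreal (r * g ((1 / s) *\<^sub>R x)) \<partial>lborel)
      = ennreal r * (\<integral>\<^sup>+x. ennreal (g ((1 / s) *\<^sub>R x)) \<partial>lborel)"
    using r by (subst nn_integral_cmult[symmetric]) (auto simp: ennreal_mult')
  then show ?thesis
    using nn_integral_lborel_scale[of "\<lambda>x. ennreal (g x)" s] s r g
    by (simp add: ennreal_mult mult.assoc)
qed

text \<open>After the triangle inequality the difference of the two sides is a perfect square over
  \<open>s * (1 - s)\<close>.\<close>

lemma norm_add_square_le:
  fixes x y :: "'a::real_normed_vector" and s :: real
  assumes "0 < s" "s < 1"
  shows "norm (x + y) ^ 2 \<le> norm x ^ 2 / (1 - s) + norm y ^ 2 / s"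
proof -
  have "norm (x + y) ^ 2 \<le> (norm x + norm y) ^ 2"
    by (intro power_mono norm_triangle_ineq) auto
  also have "\<dots> \<le> norm x ^ 2 / (1 - s) + norm y ^ 2 / s"
  proof -
    have "norm x ^ 2 / (1 - s) + norm y ^ 2 / s - (norm x + norm y) ^ 2
        = (s * norm x - (1 - s) * norm y) ^ 2 / (s * (1 - s))"
      using assms by (simp add: field_simps power2_eq_square)
    moreover have "\<dots> \<ge> 0" using assms by simp
    ultimately show ?thesis by linarith
  qed
  finally show ?thesis .
qed

text \<open>Compares \<open>cost b (s * t) f (x + y) z\<close> with \<open>cost b t f\<close> at
  \<open>(1 / s) *\<^sub>R y\<close> and the same \<open>z\<close>, splitting the quadratic term by
  \<open>norm_add_square_le\<close>. Solving for the second \<open>pert\<close> turns the claim into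
  a lower bound for all its costs.\<close>

lemma pert_subadditive:
  fixes x y :: "'a::euclidean_space"
  assumes b: "b > 0" and s: "0 < s" "s < 1" and t: "t > 0" and f: "f z0 \<noteq> 0"
  shows "pert b (s * t) f (x + y) \<le>
    (1 - s) * (1 + norm ((1 / (1 - s)) *\<^sub>R x) ^ 2 / (2 * b)) + s * pert b t f ((1 / s) *\<^sub>R y)"
proof -
  let ?A = "(1 - s) * (1 + norm ((1 / (1 - s)) *\<^sub>R x) ^ 2 / (2 * b))"
  have A: "?A = (1 - s) + norm x ^ 2 / (1 - s) / (2 * b)"
  proof -
    have "k * (1 + M / k\<^sup>2 / (2 * b)) = k + M / k / (2 * b)" if "k > 0" for k M
      using that b by (simp add: field_simps power2_eq_square)
    from this[of "1 - s" "norm x ^ 2"] show ?thesis using s by (simp add: power_divide)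
  qed
  have "(pert b (s * t) f (x + y) - ?A) / s \<le> pert b t f ((1 / s) *\<^sub>R y)"
  proof (rule pert_greatest[of f z0])
    fix z assume z: "f z \<noteq> 0"
    let ?y = "y - (s * t) *\<^sub>R z"
    have "(1 / s) *\<^sub>R y - t *\<^sub>R z = (1 / s) *\<^sub>R ?y" using s by (simp add: scaleR_diff_right)
    then have y: "s * norm ((1 / s) *\<^sub>R y - t *\<^sub>R z) ^ 2 = norm ?y ^ 2 / s"
      using s by (simp add: power_divide power2_eq_square)
    have "norm (x + ?y) ^ 2 / (2 * b) \<le> (norm x ^ 2 / (1 - s) + norm ?y ^ 2 / s) / (2 * b)"
      using s b by (intro divide_right_mono norm_add_square_le) auto
    also have "\<dots> = norm x ^ 2 / (1 - s) / (2 * b) + s * norm ((1 / s) *\<^sub>R y - t *\<^sub>R z) ^ 2 / (2 * b)"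
      unfolding y by (simp add: add_divide_distrib)
    finally have "cost b (s * t) f (x + y) z \<le> ?A + s * cost b t f ((1 / s) *\<^sub>R y) z"
      unfolding cost_def A by (simp add: algebra_simps)
    moreover have "pert b (s * t) f (x + y) \<le> cost b (s * t) f (x + y) z"
      using b s t z by (intro pert_le_cost) auto
    ultimately show "(pert b (s * t) f (x + y) - ?A) / s \<le> cost b t f ((1 / s) *\<^sub>R y) z"
      using s by (simp add: divide_le_eq mult.commute)
  qed (rule f)
  then show ?thesis using s by (simp add: divide_le_eq mult.commute)
qed

section \<open>Integral estimates for the perturbed function\<close>

context
  fixes b :: real and f :: "'a::euclidean_space \<Rightarrow> real" and z0 :: 'a
  assumes b: "b > DIM('a)"
    and f_meas: "f \<in> borel_measurable borel" and f_nonneg: "\<And>x. f x \<ge> 0" and z0: "f z0 \<noteq> 0"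
begin

text \<open>Up to normalisation and dilation, the multivariate Student density; it is
  \<open>G_alpha\<close> at the parameter \<open>- 1 / b\<close>.\<close>

definition Student :: "'a \<Rightarrow> real" where "Student x = (1 + norm x ^ 2 / (2 * b)) powr (- b)"
definition pert_integral :: "real \<Rightarrow> ennreal" where "pert_integral t = (\<integral>\<^sup>+x. ennreal (pert b t f x powr (- b)) \<partial>lborel)"

lemma b_pos: "b > 0"
  using b by (rule less_trans[rotated]) simp

lemma Student_measurable: "Student \<in> borel_measurable borel"
  unfolding Student_def by measurable

lemma Student_base_pos: "1 + norm x ^ 2 / (2 * b) > 0"
  using b_pos by (simp add: add_pos_nonneg)

lemma Student_pos: "Student x > 0"
  using Student_base_pos[of x] by (simp add: Student_def)

lemma Student_integral_pos: "(\<integral>\<^sup>+x. ennreal (Student x) \<partial>lborel) > 0"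
proof (rule ccontr)
  assume "\<not> (\<integral>\<^sup>+x. ennreal (Student x) \<partial>lborel) > 0"
  then have "emeasure lborel {x \<in> space lborel. ennreal (Student x) \<noteq> 0} = 0"
    using Student_measurable by (subst nn_integral_0_iff[symmetric]) auto
  moreover have "{x \<in> space lborel. ennreal (Student x) \<noteq> 0} = UNIV"
    using Student_pos by (auto simp: ennreal_eq_0_iff not_le)
  ultimately show False by simp
qed

lemma Student_integral_finite: "(\<integral>\<^sup>+x. ennreal (Student x) \<partial>lborel) < \<infinity>"
  unfolding Student_def using b by (rule nn_integral_Student_finite)

lemma pert_powr_meas: "t > 0 \<Longrightarrow> (\<lambda>x. pert b t f x powr (- b)) \<in> borel_measurable borel"
  using pert_measurable[of b t f z0] b_pos z0 by (intro powr_real_measurable) auto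

lemma pert_integral_chord:
  assumes s: "0 < s" "s < 1" and t: "0 < t" "t < 1" and Ft: "pert_integral t > 0"
  shows "npow (b - DIM('a)) (pert_integral (s * t)) \<le> (1 - s) * npow (b - DIM('a)) (\<integral>\<^sup>+x. ennreal (Student x) \<partial>lborel) + s * npow (b - DIM('a)) (pert_integral t)"
proof -
  define c where "c = b - DIM('a)"
  let ?u = "\<lambda>x. (1 - s) powr (- b) * Student ((1 / (1 - s)) *\<^sub>R x)"
  let ?v = "\<lambda>y. s powr (- b) * pert b t f ((1 / s) *\<^sub>R y) powr (- b)"
  have c: "c > 0" using b by (simp add: c_def)
  \<comment> \<open>Dilation by \<open>r\<close> together with the height factor
    \<open>r powr (- b)\<close> multiplies an integral by \<open>r powr (- c)\<close>, hence its
    \<open>npow c\<close> by \<open>r\<close>. This turns subadditivity into the chord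
    inequality.\<close>
  have scale: "npow c (ennreal (r powr (- b) * r ^ DIM('a)) * X) = r * npow c X" if r: "r > 0" for r X
  proof -
    have "r powr (- b) * r ^ DIM('a) = r powr (- c)"
      using r by (simp add: powr_realpow[symmetric] powr_add[symmetric] c_def)
    then show ?thesis using r c by (simp add: npow_cmult powr_powr)
  qed
  have pp: "pert b t f x > 0" for x using pert_pos[of b t f z0 x] b_pos t z0 by simp
  have u: "(\<integral>\<^sup>+x. ennreal (?u x) \<partial>lborel) = ennreal ((1 - s) powr (- b) * (1 - s) ^ DIM('a)) * (\<integral>\<^sup>+x. ennreal (Student x) \<partial>lborel)"
    using s by (intro nn_integral_scaled Student_measurable) auto
  have v: "(\<integral>\<^sup>+x. ennreal (?v x) \<partial>lborel) = ennreal (s powr (- b) * s ^ DIM('a)) * pert_integral t"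
    unfolding pert_integral_def using s t by (intro nn_integral_scaled pert_powr_meas) auto
  have "npow c (\<integral>\<^sup>+x. ennreal (pert b (s * t) f x powr (- b)) \<partial>lborel) \<le>
      npow c (\<integral>\<^sup>+x. ennreal (?u x) \<partial>lborel) + npow c (\<integral>\<^sup>+x. ennreal (?v x) \<partial>lborel)"
    unfolding c_def
  proof (rule npow_integral_subadditive[THEN conjunct2])
    show "?u \<in> borel_measurable borel" using Student_measurable by measurable
    show "?v \<in> borel_measurable borel" using pert_powr_meas[OF t(1)] by measurable
    show "(\<lambda>x. pert b (s * t) f x powr (- b)) \<in> borel_measurable borel"
      using s t by (intro pert_powr_meas) simp
    show "b > DIM('a)" by (rule b)
    show "0 < (1 - s) * (1 + norm ((1 / (1 - s)) *\<^sub>R x) ^ 2 / (2 * b))" for x :: 'a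
      using s by (intro mult_pos_pos Student_base_pos) auto
    show "?u x = ((1 - s) * (1 + norm ((1 / (1 - s)) *\<^sub>R x) ^ 2 / (2 * b))) powr (- b)" for x
      using s Student_base_pos[of "(1 / (1 - s)) *\<^sub>R x"] unfolding Student_def by (subst powr_mult) auto
    show "0 < s * pert b t f ((1 / s) *\<^sub>R y)" for y using s pp by simp
    show "?v y = (s * pert b t f ((1 / s) *\<^sub>R y)) powr (- b)" for y
      using s pp[of "(1 / s) *\<^sub>R y"] by (subst powr_mult) auto
    show "((1 - s) * (1 + norm ((1 / (1 - s)) *\<^sub>R x) ^ 2 / (2 * b)) + s * pert b t f ((1 / s) *\<^sub>R y)) powr (- b)
        \<le> pert b (s * t) f (x + y) powr (- b)" for x y
    proof (rule powr_mono2')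
      have "s * t < 1" using s t mult_strict_mono[of s 1 t 1] by simp
      then show "0 < pert b (s * t) f (x + y)" using pert_pos[of b "s * t" f z0] b_pos z0 s t by simp
    qed (use b_pos pert_subadditive[of b s t f z0 x y] s t z0 in auto)
    show "0 < (\<integral>\<^sup>+x. ennreal (?u x) \<partial>lborel)"
      unfolding u using s Student_integral_pos by (simp add: ennreal_zero_less_mult_iff)
    show "0 < (\<integral>\<^sup>+x. ennreal (?v x) \<partial>lborel)"
      unfolding v using s Ft by (simp add: ennreal_zero_less_mult_iff)
  qed
  then show ?thesis
    unfolding u v pert_integral_def[symmetric] c_def[symmetric] using s scale by simp
qed

text \<open>The constant \<open>1 - t\<close> is grouped with the quadratic term of
  \<open>cost\<close>. That part is \<open>Student\<close> dilated by \<open>sqrt (1 - t)\<close>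
  with height factor \<open>(1 - t) powr (- b)\<close>, so its integral scales with exponent
  \<open>n / 2 - b\<close> in dimension n; taking the power \<open>- 1 / c\<close> gives the
  exponent in the statement.\<close>

lemma pert_integral_upper:
  assumes t: "0 < t" "t < 1" and If: "0 < (\<integral>\<^sup>+x. ennreal (f x) \<partial>lborel)"
  shows "pert_integral t > 0"
    and "npow (b - DIM('a)) (pert_integral t) \<le>
      (1 - t) powr ((b - DIM('a) / 2) / (b - DIM('a))) * npow (b - DIM('a)) (\<integral>\<^sup>+x. ennreal (Student x) \<partial>lborel)
      + t * npow (b - DIM('a)) (\<integral>\<^sup>+x. ennreal (f x) \<partial>lborel)"
proof -
  define c where "c = b - DIM('a)"
  let ?r = "sqrt (1 - t)"
  let ?A = "\<lambda>x. 1 - t + norm x ^ 2 / (2 * b)"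
  let ?u = "\<lambda>x::'a. ?A x powr (- b)"
  let ?v = "\<lambda>y. t powr (- b) * f ((1 / t) *\<^sub>R y)"
  have c: "c > 0" using b by (simp add: c_def)
  have r: "?r > 0" using t by simp
  have A: "?A x > 0" for x :: 'a using t b_pos by (simp add: add_pos_nonneg)
  have "?u x = (1 - t) powr (- b) * Student ((1 / ?r) *\<^sub>R x)" for x
  proof -
    have "?A x = (1 - t) * (1 + norm ((1 / ?r) *\<^sub>R x) ^ 2 / (2 * b))"
    proof -
      have "k + M / (2 * b) = k * (1 + M / k / (2 * b))" if "k > 0" for k M
        using that b_pos by (simp add: field_simps)
      from this[of "1 - t" "norm x ^ 2"] show ?thesis using t by (simp add: power_divide)
    qed
    then show ?thesis
      using t Student_base_pos[of "(1 / ?r) *\<^sub>R x"] by (simp add: Student_def powr_mult)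
  qed
  then have u: "(\<integral>\<^sup>+x. ennreal (?u x) \<partial>lborel) = ennreal ((1 - t) powr (- b) * ?r ^ DIM('a)) * (\<integral>\<^sup>+x. ennreal (Student x) \<partial>lborel)"
    using t by (simp add: nn_integral_scaled Student_measurable del: scaleR_one)
  have v: "(\<integral>\<^sup>+x. ennreal (?v x) \<partial>lborel) = ennreal (t powr (- b) * t ^ DIM('a)) * (\<integral>\<^sup>+x. ennreal (f x) \<partial>lborel)"
    using t by (intro nn_integral_scaled f_meas) auto
  have "0 < (\<integral>\<^sup>+x. ennreal (pert b t f x powr (- b)) \<partial>lborel) \<and>
    npow c (\<integral>\<^sup>+x. ennreal (pert b t f x powr (- b)) \<partial>lborel) \<le>
      npow c (\<integral>\<^sup>+x. ennreal (?u x) \<partial>lborel) + npow c (\<integral>\<^sup>+x. ennreal (?v x) \<partial>lborel)"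
    unfolding c_def
  proof (rule npow_integral_subadditive[where A = ?A and B = "\<lambda>y. t * f ((1 / t) *\<^sub>R y) powr (- 1 / b)"])
    show "?u \<in> borel_measurable borel" by measurable
    show "?v \<in> borel_measurable borel" using f_meas by measurable
    show "(\<lambda>x. pert b t f x powr (- b)) \<in> borel_measurable borel"
      using t by (intro pert_powr_meas) simp
    show "b > DIM('a)" by (rule b)
    show "0 < t * f ((1 / t) *\<^sub>R y) powr (- 1 / b)" if "?v y \<noteq> 0" for y
      using that t by simp
    show "?v y = (t * f ((1 / t) *\<^sub>R y) powr (- 1 / b)) powr (- b)" for y
      using t b_pos f_nonneg by (simp add: powr_mult powr_powr)
    show "(?A x + t * f ((1 / t) *\<^sub>R y) powr (- 1 / b)) powr (- b) \<le> pert b t f (x + y) powr (- b)"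
      if "?v y \<noteq> 0" for x y
    proof (rule powr_mono2')
      show "0 < pert b t f (x + y)" using pert_pos[of b t f z0] b_pos z0 t by simp
      have "f ((1 / t) *\<^sub>R y) \<noteq> 0" using that by simp
      then show "pert b t f (x + y) \<le> ?A x + t * f ((1 / t) *\<^sub>R y) powr (- 1 / b)"
        using pert_le_cost[of b t f "(1 / t) *\<^sub>R y" "x + y"] b_pos t by (simp add: cost_def)
    qed (use b_pos in auto)
    show "0 < (\<integral>\<^sup>+x. ennreal (?u x) \<partial>lborel)"
      unfolding u using t Student_integral_pos by (simp add: ennreal_zero_less_mult_iff)
    show "0 < (\<integral>\<^sup>+x. ennreal (?v x) \<partial>lborel)"
      unfolding v using t If by (simp add: ennreal_zero_less_mult_iff)
  qed (use A in auto)
  moreover have "npow c (ennreal ((1 - t) powr (- b) * ?r ^ DIM('a)) * (\<integral>\<^sup>+x. ennreal (Student x) \<partial>lborel))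
      = (1 - t) powr ((b - DIM('a) / 2) / c) * npow c (\<integral>\<^sup>+x. ennreal (Student x) \<partial>lborel)"
  proof -
    define d where "d = b - DIM('a) / 2"
    have "(1 - t) powr (- b) * ?r ^ DIM('a) = (1 - t) powr (- d)"
      using t by (simp add: powr_realpow[symmetric] powr_half_sqrt[symmetric] powr_powr powr_add[symmetric]
          d_def)
    then show ?thesis unfolding d_def[symmetric] using t by (simp add: npow_cmult powr_powr)
  qed
  moreover have "npow c (ennreal (t powr (- b) * t ^ DIM('a)) * X) = t * npow c X" for X
  proof -
    have "t powr (- b) * t ^ DIM('a) = t powr (- c)"
      using t by (simp add: powr_realpow[symmetric] powr_add[symmetric] c_def)
    then show ?thesis using t c by (simp add: npow_cmult powr_powr)
  qed
  ultimately show "pert_integral t > 0" and "npow (b - DIM('a)) (pert_integral t) \<le>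
      (1 - t) powr ((b - DIM('a) / 2) / (b - DIM('a))) * npow (b - DIM('a)) (\<integral>\<^sup>+x. ennreal (Student x) \<partial>lborel)
      + t * npow (b - DIM('a)) (\<integral>\<^sup>+x. ennreal (f x) \<partial>lborel)"
    unfolding u v pert_integral_def c_def[symmetric] by simp_all
qed

end


section \<open>Existence of the limit and the lower bound\<close>

theorem theorem3p7:
  fixes f :: "'a::euclidean_space \<Rightarrow> real" and \<alpha> :: real
  defines "n \<equiv> real DIM('a)"
  defines "\<kappa> \<equiv> \<alpha> / (1 + n * \<alpha>)"
  assumes "-1 / n < \<alpha>" and "\<alpha> < 0"
    and "f \<in> C_alpha \<alpha>"
  shows "w_alpha \<alpha> f \<ge>
     ereal (real_of_ereal (integ (G_alpha \<alpha> :: 'a \<Rightarrow> real))) *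
       (ereal (n / 2) + ereal (1 / \<kappa>) * ratio_pow (integ f) (real_of_ereal (integ (G_alpha \<alpha> :: 'a \<Rightarrow> real))) \<kappa>
        - ereal (1 / \<kappa>))"
proof -
  define b where "b = - 1 / \<alpha>"
  have n: "n \<ge> 1" by (simp add: n_def Suc_leI)
  have \<alpha>: "\<alpha> = - 1 / b" using \<open>\<alpha> < 0\<close> by (simp add: b_def)
  have bn: "b > n" using assms(3,4) n by (simp add: b_def field_simps)
  then have b: "b > DIM('a)" by (simp add: n_def)
  have b0: "b > 0" using bn n by simp
  define c where "c = b - n"
  define \<theta> where "\<theta> = (b - n / 2) / c"
  have c: "c > 0" using bn by (simp add: c_def)
  have \<kappa>: "\<kappa> = - 1 / c" using b0 bn by (simp add: \<kappa>_def \<alpha> c_def field_simps)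
  \<comment> \<open>Source of the summand \<open>n / 2\<close> in the bound.\<close>
  have \<theta>: "c * \<theta> = c + n / 2" using c by (simp add: \<theta>_def) (simp add: c_def)
  have f: "usc f" "\<And>x. f x \<ge> 0" and "\<exists>x. f x \<noteq> 0"
    using assms(5) by (auto simp: C_alpha_def alpha_concave_def)
  then obtain z0 where z0: "f z0 \<noteq> 0" by auto
  have f_meas: "f \<in> borel_measurable borel" using f(1) by (rule usc_borel_measurable)
  note ctx = b f_meas f(2) z0
  have G: "G_alpha \<alpha> = (Student b :: 'a \<Rightarrow> real)"
    using b0 by (simp add: fun_eq_iff G_alpha_def Student_def[OF ctx] \<alpha>)
  define j where "j = enn2real (\<integral>\<^sup>+x. ennreal (Student b (x::'a)) \<partial>lborel)"
  have J: "(\<integral>\<^sup>+x. ennreal (Student b (x::'a)) \<partial>lborel) = ennreal j"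
    using Student_integral_finite[OF ctx] by (simp add: j_def)
  have j: "j > 0" using Student_integral_pos[OF ctx] unfolding J by simp
  have intG: "integ (G_alpha \<alpha> :: 'a \<Rightarrow> real) = ereal j"
    using j by (simp add: integ_def G J enn2ereal_ennreal)
  define I where "I = (\<integral>\<^sup>+x. ennreal (f x) \<partial>lborel)"
  have intf: "integ f = enn2ereal I" by (simp add: integ_def I_def)
  show ?thesis
  proof (cases "I = 0")
    \<comment> \<open>Since \<open>\<kappa>\<close> is negative, \<open>ratio_pow\<close> is
      infinite and its coefficient \<open>1 / \<kappa> = - c\<close> is negative: the right side is
      minus infinity.\<close>
    case True
    then have "ratio_pow (integ f) j \<kappa> = \<infinity>" by (simp add: intf ratio_pow_def zero_ennreal.rep_eq)
    then show ?thesis using c j by (simp add: intG \<kappa>)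
  next
    case False
    then have I: "I > 0" by (simp add: less_le)
    define K where "K = npow c I"
    obtain L where lim: "((\<lambda>t. (enn2ereal (pert_integral b f t) - ereal j) * ereal (1 / t)) \<longlongrightarrow> L) (at_right 0)"
      and L: "ereal (c * j powr (1 + 1 / c) * (\<theta> * npow c (ennreal j) - K)) \<le> L"
    proof (rule right_quotient_limit)
      show pos: "pert_integral b f t > 0" if "0 < t" "t < 1" for t
        using pert_integral_upper(1)[OF ctx that] I by (simp add: I_def)
      show "npow c (pert_integral b f (s * t)) \<le> (1 - s) * npow c (ennreal j) + s * npow c (pert_integral b f t)"
        if "0 < s" "s < 1" "0 < t" "t < 1" for s t
        using pert_integral_chord[OF ctx that pos] that by (simp add: J c_def n_def)
      show "npow c (pert_integral b f t) \<le> (1 - t) powr \<theta> * npow c (ennreal j) + t * K"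
        if "0 < t" "t < 1" for t
        using pert_integral_upper(2)[OF ctx that] I by (simp add: J I_def K_def \<theta>_def c_def n_def)
    qed (use c j in auto)
    have "integ (alpha_sum \<alpha> (G_alpha \<alpha>) (alpha_scale \<alpha> t f)) = enn2ereal (pert_integral b f t)"
      if "0 < t" "t < 1" for t
      unfolding integ_def \<alpha> pert_integral_def[OF ctx]
      using alpha_sum_eq_pert[OF b0 that, of f z0] z0 by simp
    then have "\<forall>\<^sub>F t in at_right 0. (enn2ereal (pert_integral b f t) - ereal j) * ereal (1 / t) =
        (integ (alpha_sum \<alpha> (G_alpha \<alpha>) (alpha_scale \<alpha> t f)) - integ (G_alpha \<alpha> :: 'a \<Rightarrow> real)) * ereal (1 / t)"
      using eventually_at_right_real[OF zero_less_one] intG by (auto elim!: eventually_mono)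
    then have "w_alpha \<alpha> f = L"
      unfolding w_alpha_def
      by (intro tendsto_Lim Lim_transform_eventually[OF lim]) auto
    \<comment> \<open>If \<open>I\<close> is infinite, \<open>K = 0\<close> agrees with the
      convention that the ratio power is 0.\<close>
    moreover have "ereal (1 / \<kappa>) * ratio_pow (integ f) j \<kappa> = ereal (- c * (K * j powr (1 / c)))"
    proof (cases I)
      case (real i)
      then have "i > 0" using I by simp
      then have "ratio_pow (integ f) j \<kappa> = ereal (K * j powr (1 / c))"
        using real j by (simp add: intf ratio_pow_def enn2ereal_ennreal K_def npow_ennreal \<kappa>
          powr_divide powr_minus field_simps)
      then show ?thesis by (simp add: \<kappa>)
    next
      case top
      then show ?thesis by (simp add: intf ratio_pow_def K_def npow_def)
    qed
    \<comment> \<open>Matches the derivative bound from \<open>right_quotient_limit\<close> with the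
      stated form, using \<open>c * \<theta> = c + n / 2\<close> and
      \<open>c = - 1 / \<kappa>\<close>.\<close>
    moreover have "j * (n / 2 + - c * (K * j powr (1 / c)) - 1 / \<kappa>) =
        c * j powr (1 + 1 / c) * (\<theta> * npow c (ennreal j) - K)"
    proof -
      have 1: "j powr (1 + 1 / c) = j * j powr (1 / c)" using j by (simp add: powr_add)
      have 2: "npow c (ennreal j) * j powr (1 / c) = 1"
        using j by (simp add: npow_ennreal powr_add[symmetric])
      have "c * j powr (1 + 1 / c) * (\<theta> * npow c (ennreal j) - K)
          = j * ((c * \<theta>) * (npow c (ennreal j) * j powr (1 / c)) - c * (K * j powr (1 / c)))"
        unfolding 1 by (simp add: algebra_simps)
      then show ?thesis unfolding 2 \<theta> using c by (simp add: \<kappa>)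
    qed
    ultimately show ?thesis using L by (simp add: intG)
  qed
qed

end
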